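(* There is a family of unsatisfiable CNF formulas $\{F_n\}_{n=0}^\infty$ with a number of variables polynomial in $n$ such that $\mathrm{VSpace}_{\mathrm{PC}}(F_n\vdash)=O(n)$ and $\mathrm{VSpace}_{\mathrm{MC}}(F_n\vdash)=\Omega\!\left(\frac{n\log n}{\log\log n}\right)$.
   Context: CNF formulas are encoded as polynomials over a field $\mathbb F$: a clause $\bigvee_{x\in P}x\vee\bigvee_{y\in N}\bar y$ becomes $\prod_{x\in P}(1-x)\prod_{y\in N}y$; Boolean axioms $x_i^2-x_i$ are available. Polynomial Calculus (PC) uses linear combination ($\alpha p+\beta q$, $\alpha,\beta\in\mathbb F$) and multiplication $p\mapsto x_ip$ of any polynomial by a variable; Monomial Calculus (MC) is the same but multiplication is only allowed when $p$ is a monomial or the product of a monomial and an axiom. A configurational refutation is a sequence of sets of polynomials $C_0=\emptyset,\dots,C_t=\{1\}$, each obtained from the previous by adding an axiom, erasing a polynomial, or adding a polynomial inferred by a rule of the system. Its variable space is the maximum number of distinct variables in one configuration; $\mathrm{VSpace}_{\mathcal C}(F\vdash)$ is the minimum variable space of a refutation of (the encoding of) $F$ in system $\mathcal C$. *)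

theory Defs
  imports Complex_Main "HOL-Library.Poly_Mapping" "HOL-Library.Landau_Symbols"
begin

section \<open>CNF formulas\<close>

datatype literal = Pos nat | Neg nat

type_synonym clause = "literal set"
type_synonym cnf = "clause set"

fun lit_var :: "literal \<Rightarrow> nat" where
  "lit_var (Pos x) = x"
| "lit_var (Neg x) = x"

fun lit_true :: "(nat \<Rightarrow> bool) \<Rightarrow> literal \<Rightarrow> bool" where
  "lit_true v (Pos x) = v x"
| "lit_true v (Neg x) = (\<not> v x)"

definition is_cnf :: "cnf \<Rightarrow> bool" where
  "is_cnf F \<longleftrightarrow> finite F \<and> (\<forall>C\<in>F. finite C)"

definition cnf_vars :: "cnf \<Rightarrow> nat set" where
  "cnf_vars F = (\<Union>C\<in>F. lit_var ` C)"

definition unsatisfiable :: "cnf \<Rightarrow> bool" where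
  "unsatisfiable F \<longleftrightarrow> \<not> (\<exists>v. \<forall>C\<in>F. \<exists>l\<in>C. lit_true v l)"


section \<open>Polynomials and the encoding of formulas\<close>

text \<open>
  A power product is a finitely supported map from variables to exponents; a polynomial is a
  finitely supported map from power products to coefficients. The ring structure is the
  (convolution) instance of the library. Polynomials are not reduced modulo
  the Boolean axioms.
\<close>

type_synonym 'a polynomial = "(nat \<Rightarrow>\<^sub>0 nat) \<Rightarrow>\<^sub>0 'a"

definition Var :: "nat \<Rightarrow> 'a::field polynomial" where
  "Var x = Poly_Mapping.single (Poly_Mapping.single x 1) 1"

definition Const :: "'a::field \<Rightarrow> 'a polynomial" where
  "Const c = Poly_Mapping.single 0 c"

definition poly_vars :: "'a::field polynomial \<Rightarrow> nat set" where
  "poly_vars p = (\<Union>m\<in>Poly_Mapping.keys p. Poly_Mapping.keys m)"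

text \<open>
  Monomials have coefficient one, and the empty product \<open>1\<close> is a monomial; in particular
  every axiom is the product of a monomial and an axiom.
\<close>

definition is_monomial :: "'a::field polynomial \<Rightarrow> bool" where
  "is_monomial p \<longleftrightarrow> (\<exists>m. p = Poly_Mapping.single m 1)"

text \<open>Truth is encoded by the value \<open>1\<close> of a variable, and a true clause by a vanishing polynomial.\<close>

fun lit_poly :: "literal \<Rightarrow> 'a::field polynomial" where
  "lit_poly (Pos x) = 1 - Var x"
| "lit_poly (Neg y) = Var y"

definition clause_poly :: "clause \<Rightarrow> 'a::field polynomial" where
  "clause_poly C = (\<Prod>l\<in>C. lit_poly l)"

definition axioms_of :: "cnf \<Rightarrow> 'a::field polynomial set" where
  "axioms_of F = clause_poly ` F \<union> (\<lambda>x. Var x ^ 2 - Var x) ` cnf_vars F"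


section \<open>Polynomial Calculus and Monomial Calculus\<close>

datatype calculus = PC | MC

type_synonym 'a config = "'a polynomial set"

fun mult_allowed :: "calculus \<Rightarrow> cnf \<Rightarrow> 'a::field polynomial \<Rightarrow> bool" where
  "mult_allowed PC F p \<longleftrightarrow> True"
| "mult_allowed MC F p \<longleftrightarrow>
     is_monomial p \<or> (\<exists>m. \<exists>a\<in>axioms_of F. is_monomial m \<and> p = m * a)"

inductive inferred :: "calculus \<Rightarrow> cnf \<Rightarrow> 'a::field config \<Rightarrow> 'a polynomial \<Rightarrow> bool"
  for S :: calculus and F :: cnf and C :: "'a::field config" where
  linear_combination:
    "p \<in> C \<Longrightarrow> q \<in> C \<Longrightarrow> inferred S F C (Const \<alpha> * p + Const \<beta> * q)"
| multiplication:
    "p \<in> C \<Longrightarrow> x \<in> cnf_vars F \<Longrightarrow> mult_allowed S F p \<Longrightarrow> inferred S F C (Var x * p)"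

inductive step :: "calculus \<Rightarrow> cnf \<Rightarrow> 'a::field config \<Rightarrow> 'a config \<Rightarrow> bool"
  for S :: calculus and F :: cnf and C :: "'a::field config" where
  download: "a \<in> axioms_of F \<Longrightarrow> step S F C (insert a C)"
| erasure: "p \<in> C \<Longrightarrow> step S F C (C - {p})"
| inference: "inferred S F C p \<Longrightarrow> step S F C (insert p C)"

definition is_refutation :: "calculus \<Rightarrow> cnf \<Rightarrow> 'a::field config list \<Rightarrow> bool" where
  "is_refutation S F \<pi> \<longleftrightarrow>
     \<pi> \<noteq> [] \<and> hd \<pi> = {} \<and> last \<pi> = {1} \<and> successively (step S F) \<pi>"

definition config_vars :: "'a::field config \<Rightarrow> nat set" where
  "config_vars C = (\<Union>p\<in>C. poly_vars p)"

definition refutation_vspace :: "'a::field config list \<Rightarrow> nat" where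
  "refutation_vspace \<pi> = Max ((\<lambda>C. card (config_vars C)) ` set \<pi>)"

text \<open>
  The type argument fixes the coefficient field. On \<^typ>\<open>nat\<close> the infimum of a nonempty set is
  its minimum; the set is nonempty for every unsatisfiable CNF formula, since both systems
  are complete. (The infimum of the empty set would be \<open>0\<close>.)
\<close>

definition VSpace :: "'a::field itself \<Rightarrow> calculus \<Rightarrow> cnf \<Rightarrow> nat" where
  "VSpace _ S F = Inf (refutation_vspace ` {\<pi> :: 'a config list. is_refutation S F \<pi>})"

end

theory Submission
  imports Defs "HOL-Real_Asymp.Real_Asymp"
begin

text \<open>
  The variables form blocks \<open>0, \<dots>, M + 1\<close> of \<open>5d\<close> variables. A string on a block is good or bad,
  and the formula says that block \<open>0\<close> is not bad, block \<open>M + 1\<close> is not good, and no good block is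
  followed by a bad one. PC remembers only ``block \<open>b\<close> is good'' and walks along the chain in the
  variables of two blocks.

  A linear combination of products of axioms with monomials that refutes the chain statically is
  a reversible pebbling of a path, and costs \<open>d\<close> times a logarithm of the length. MC can do better
  only through monomials that it has derived. The lower bound uses functionals, given
  by frames, that kill all products of monomials and axioms with fewer than \<open>d (K + 1)\<close> variables, and
  such that the monomials killed by all of them are closed under multiplication by variables; so MC
  stays in their kernel. A frame fixes the blocks outside an interval, good on the left and bad on
  the right, and is a pebbling functional inside. A small monomial meets at most \<open>K\<close> blocks in at
  least \<open>d\<close> variables. Fixing these blocks costs a factor \<open>K + 1\<close> in the length of the interval and
  uses strings with two variables fewer than before. Since one of \<open>K + 1\<close> cardinalities is not
  attained by the monomial, the fixing can always be restarted there, and a chain of length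
  \<open>(2 K + 2) ^ (K + 1)\<close> suffices.
\<close>

subsection \<open>Variables of polynomials\<close>

lemma keys_plus_nat: "Poly_Mapping.keys (k + l) = Poly_Mapping.keys k \<union> Poly_Mapping.keys l"
  for k l :: "nat \<Rightarrow>\<^sub>0 nat"
  by (auto simp: in_keys_iff lookup_add)

lemma poly_vars_finite [simp]: "finite (poly_vars p)"
  by (simp add: poly_vars_def)

lemma poly_vars_add: "poly_vars (p + q) \<subseteq> poly_vars p \<union> poly_vars q"
  unfolding poly_vars_def using keys_add[of p q] by fastforce

lemma poly_vars_mult: "poly_vars (p * q) \<subseteq> poly_vars p \<union> poly_vars q"
proof
  fix x assume "x \<in> poly_vars (p * q)"
  then obtain m where m: "m \<in> Poly_Mapping.keys (p * q)" "x \<in> Poly_Mapping.keys m"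
    by (auto simp: poly_vars_def)
  then obtain k l where "m = k + l" "k \<in> Poly_Mapping.keys p" "l \<in> Poly_Mapping.keys q"
    using keys_mult[of p q] by auto
  then show "x \<in> poly_vars p \<union> poly_vars q"
    using m(2) by (auto simp: poly_vars_def keys_plus_nat)
qed

lemma poly_vars_0 [simp]: "poly_vars 0 = {}"
  by (simp add: poly_vars_def)

lemma poly_vars_1 [simp]: "poly_vars 1 = {}"
  by (simp add: poly_vars_def)

lemma poly_vars_Const [simp]: "poly_vars (Const c) = {}"
  by (simp add: poly_vars_def Const_def)

lemma poly_vars_Var [simp]: "poly_vars (Var x :: 'a::field polynomial) = {x}"
  by (simp add: poly_vars_def Var_def)

lemma poly_vars_uminus [simp]: "poly_vars (- p) = poly_vars p"
  by (simp add: poly_vars_def in_keys_iff set_eq_iff)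

lemma poly_vars_diff: "poly_vars (p - q) \<subseteq> poly_vars p \<union> poly_vars q"
  using poly_vars_add[of p "- q"] by simp

lemma poly_vars_prod: "poly_vars (\<Prod>i\<in>I. f i) \<subseteq> (\<Union>i\<in>I. poly_vars (f i))"
proof (induction I rule: infinite_finite_induct)
  case (insert i I)
  then show ?case
    using poly_vars_mult[of "f i" "\<Prod>i\<in>I. f i"] by auto
qed auto

lemma poly_vars_lit_poly: "poly_vars (lit_poly l :: 'a::field polynomial) \<subseteq> {lit_var l}"
  by (cases l) (use poly_vars_diff[of 1 "Var _ :: 'a polynomial"] in auto)

lemma poly_vars_clause_poly_subset:
  "poly_vars (clause_poly C :: 'a::field polynomial) \<subseteq> lit_var ` C"
  unfolding clause_poly_def
  using poly_vars_prod[of "lit_poly :: literal \<Rightarrow> 'a polynomial" C]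
    poly_vars_lit_poly[where 'a='a] by blast

text \<open>Multiplying by a monomial shifts exponents injectively, so no terms cancel and no
  variable disappears. A space bound on a product of a monomial and an axiom thus applies to both
  factors together.\<close>

lemma poly_vars_single_mult_superset:
  assumes "p \<noteq> (0 :: 'a::field polynomial)"
  shows "Poly_Mapping.keys k \<union> poly_vars p \<subseteq> poly_vars (Poly_Mapping.single k 1 * p)"
proof -
  have lk: "Poly_Mapping.lookup (Poly_Mapping.single k 1 * p) (k + m) = Poly_Mapping.lookup p m" for m
  proof -
    have "Poly_Mapping.lookup (Poly_Mapping.single k 1 * p) (k + m) =
        prod_fun (\<lambda>l. (1 when k = l)) (Poly_Mapping.lookup p) (k + m)"
      by (simp add: lookup_mult prod_fun_def lookup_single)
    also have "\<dots> = (\<Sum>q. Poly_Mapping.lookup p q when k + m = k + q)"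
      unfolding prod_fun_def by (simp add: when_mult)
    also have "\<dots> = Poly_Mapping.lookup p m"
      by (simp add: eq_commute[of m])
    finally show ?thesis .
  qed
  have km: "k + m \<in> Poly_Mapping.keys (Poly_Mapping.single k 1 * p)" if "m \<in> Poly_Mapping.keys p" for m
    using that by (simp add: in_keys_iff lk)
  obtain m0 where "m0 \<in> Poly_Mapping.keys p"
    using assms by fastforce
  then have "Poly_Mapping.keys k \<subseteq> poly_vars (Poly_Mapping.single k 1 * p)"
    using km[of m0] keys_plus_nat[of k m0] unfolding poly_vars_def by blast
  moreover have "poly_vars p \<subseteq> poly_vars (Poly_Mapping.single k 1 * p)"
  proof
    fix x assume "x \<in> poly_vars p"
    then obtain m where "m \<in> Poly_Mapping.keys p" "x \<in> Poly_Mapping.keys (k + m)"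
      by (auto simp: poly_vars_def keys_plus_nat)
    then show "x \<in> poly_vars (Poly_Mapping.single k 1 * p)"
      using km unfolding poly_vars_def by blast
  qed
  ultimately show ?thesis by blast
qed

subsection \<open>Linear functionals that depend only on the support of a monomial\<close>

text \<open>A functional is given by its values on monomials. Since these depend only on supports,
  multiples of Boolean axioms are killed automatically. Evaluation at the assignment with true set
  \<open>y\<close> is the case \<open>e S = of_bool (S \<subseteq> y)\<close>.\<close>

definition lfun :: "(nat set \<Rightarrow> 'a) \<Rightarrow> 'a::field polynomial \<Rightarrow> 'a" where
  "lfun e p = (\<Sum>k\<in>Poly_Mapping.keys p. Poly_Mapping.lookup p k * e (Poly_Mapping.keys k))"

lemma lfun_superset:
  assumes "finite A" "Poly_Mapping.keys p \<subseteq> A"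
  shows "lfun e p = (\<Sum>k\<in>A. Poly_Mapping.lookup p k * e (Poly_Mapping.keys k))"
  unfolding lfun_def using assms by (intro sum.mono_neutral_left) (auto simp: in_keys_iff)

lemma lfun_0 [simp]: "lfun e 0 = 0"
  by (simp add: lfun_def)

lemma lfun_add: "lfun e (p + q) = lfun e p + lfun e q"
proof -
  let ?A = "Poly_Mapping.keys p \<union> Poly_Mapping.keys q"
  have "Poly_Mapping.keys (p + q) \<subseteq> ?A"
    by (rule keys_add)
  then show ?thesis
    by (simp add: lfun_superset[of ?A] lookup_add distrib_right sum.distrib)
qed

lemma lfun_sum: "lfun e (\<Sum>i\<in>I. f i) = (\<Sum>i\<in>I. lfun e (f i))"
  by (induction I rule: infinite_finite_induct) (auto simp: lfun_add)

lemma lfun_single [simp]: "lfun e (Poly_Mapping.single k c) = c * e (Poly_Mapping.keys k)"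
  by (simp add: lfun_def)

lemma polynomial_sum_single:
  "(p :: 'a::field polynomial) = (\<Sum>k\<in>Poly_Mapping.keys p. Poly_Mapping.single k (Poly_Mapping.lookup p k))"
  by (rule poly_mapping_eqI) (simp add: lookup_sum lookup_single when_def in_keys_iff)

text \<open>A monomial factor can be absorbed into \<open>e\<close>, so killing all products with an
  axiom means killing the axiom by a modified functional.\<close>

lemma lfun_single_mult:
  "lfun e (Poly_Mapping.single k c * p) = c * lfun (\<lambda>S. e (Poly_Mapping.keys k \<union> S)) p"
proof -
  have "Poly_Mapping.single k c * p =
      (\<Sum>l\<in>Poly_Mapping.keys p. Poly_Mapping.single (k + l) (c * Poly_Mapping.lookup p l))"
    by (subst (1) polynomial_sum_single) (simp add: sum_distrib_left mult_single)
  then have "lfun e (Poly_Mapping.single k c * p) =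
      (\<Sum>l\<in>Poly_Mapping.keys p. c * Poly_Mapping.lookup p l * e (Poly_Mapping.keys (k + l)))"
    by (simp only: lfun_sum lfun_single)
  then show ?thesis
    by (simp add: keys_plus_nat lfun_def sum_distrib_left mult.assoc)
qed

lemma lfun_Const_mult [simp]: "lfun e (Const c * p) = c * lfun e p"
  unfolding Const_def by (simp add: lfun_single_mult)

lemma lfun_Var_mult [simp]: "lfun e (Var x * p) = lfun (\<lambda>S. e (insert x S)) p"
  unfolding Var_def by (simp add: lfun_single_mult)

lemma lfun_uminus [simp]: "lfun e (- p) = - lfun e p"
  using lfun_add[of e p "- p"] by (simp add: eq_neg_iff_add_eq_0 add.commute)

lemma lfun_diff: "lfun e (p - q) = lfun e p - lfun e q"
  using lfun_add[of e p "- q"] by simp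

lemma lfun_cong:
  assumes "\<And>S. S \<subseteq> poly_vars p \<Longrightarrow> e S = e' S"
  shows "lfun e p = lfun e' p"
  unfolding lfun_def by (rule sum.cong) (auto intro!: arg_cong[of "e _"] assms simp: poly_vars_def)

lemma lfun_zero_fun [simp]: "lfun (\<lambda>S. 0) p = 0"
  by (simp add: lfun_def)

lemma lfun_add_fun: "lfun (\<lambda>S. e S + e' S) p = lfun e p + lfun e' p"
  by (simp add: lfun_def distrib_left sum.distrib)

lemma lfun_cmult_fun: "lfun (\<lambda>S. c * e S) p = c * lfun e p"
  by (simp add: lfun_def sum_distrib_left mult.left_commute)

lemma lfun_sum_fun: "lfun (\<lambda>S. \<Sum>i\<in>I. e i S) p = (\<Sum>i\<in>I. lfun (e i) p)"
  by (induction I rule: infinite_finite_induct) (auto simp: lfun_add_fun)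

subsection \<open>Reversible pebbling of a path\<close>

text \<open>The reversible pebble game on a path, played downwards from \<open>q\<close>, which acts
  as a permanent pebble outside the count.\<close>

inductive peb_step :: "nat \<Rightarrow> nat \<Rightarrow> nat set \<Rightarrow> nat set \<Rightarrow> bool" for K q where
  place: "Suc b \<in> insert q Q \<Longrightarrow> b \<notin> Q \<Longrightarrow> card (insert b Q) \<le> K \<Longrightarrow> peb_step K q Q (insert b Q)"
| remove: "Suc b \<in> insert q Q \<Longrightarrow> b \<notin> Q \<Longrightarrow> card (insert b Q) \<le> K \<Longrightarrow> peb_step K q (insert b Q) Q"

abbreviation pebbles :: "nat \<Rightarrow> nat \<Rightarrow> nat set \<Rightarrow> nat set \<Rightarrow> bool" where
  "pebbles K q \<equiv> (peb_step K q)\<^sup>*\<^sup>*"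

lemma peb_step_sym: "peb_step K q Q Q' \<Longrightarrow> peb_step K q Q' Q"
  by (auto elim!: peb_step.cases intro: peb_step.intros)

lemma pebbles_sym: "pebbles K q Q Q' \<Longrightarrow> pebbles K q Q' Q"
  by (induction rule: rtranclp_induct) (auto dest: peb_step_sym intro: converse_rtranclp_into_rtranclp)

lemma pebbles_finite:
  assumes "pebbles K q {} Q"
  shows "finite Q"
  using assms by (induction rule: rtranclp_induct) (auto elim: peb_step.cases)

text \<open>Bennett's bound. The configuration is cut at the point \<open>c\<close> at distance \<open>2 ^ K\<close> from \<open>q\<close>. As long
  as there are pebbles beyond \<open>c\<close>, at most \<open>K\<close> pebbles are in front, and these cannot be removed
  without reaching \<open>c\<close> with \<open>K\<close> pebbles only.\<close>

lemma pebbles_close: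
  assumes "pebbles K q {} Q" "b \<in> Q"
  shows "q < b + 2 ^ K"
  using assms
proof (induction K arbitrary: q Q b)
  case 0
  have "Q = {}"
    using 0(1)
  proof (induction rule: rtranclp_induct)
    case (step Q Q')
    then have "finite Q'" using pebbles_finite[of 0 q Q'] by auto
    with step show ?case by (auto elim!: peb_step.cases)
  qed simp
  with 0 show ?case by simp
next
  case (Suc K)
  show ?case
  proof (cases "2 ^ K \<le> q")
    case False
    then show ?thesis by simp
  next
    case True
    define c where "c = q - 2 ^ K"
    have q: "q = c + 2 ^ K"
      using True by (simp add: c_def)
    then have "c < q" by simp
    let ?near = "\<lambda>Q. Q \<inter> {c..}" and ?far = "\<lambda>Q. Q \<inter> {..<c}"
    \<comment> \<open>The far part is played as if \<open>c\<close> carried a permanent pebble. The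
      witness \<open>N\<close> justifies this: it contains \<open>c\<close> and is connected to the
      present near part by moves with \<open>K\<close> pebbles.\<close>
    define inv where "inv Q \<longleftrightarrow> ?far Q = {} \<or>
      (\<exists>N. c \<in> N \<and> pebbles K q N (?near Q) \<and> pebbles K c {} (?far Q))" for Q
    \<comment> \<open>By reversibility, an empty near part would let \<open>K\<close> pebbles reach
      \<open>c\<close> from nothing, although \<open>c\<close> has distance \<open>2 ^ K\<close>
      from \<open>q\<close>.\<close>
    have near_ne: "?near Q \<noteq> {}" if "c \<in> N" "pebbles K q N (?near Q)" for N Q
    proof
      assume "?near Q = {}"
      with that have "pebbles K q {} N" using pebbles_sym by fastforce
      from Suc.IH[OF this that(1)] q show False by simp
    qed
    have card_split: "card Q = card (?near Q) + card (?far Q)" if "finite Q" for Q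
      using that by (subst card_Un_disjoint[symmetric]) (auto intro: arg_cong[of _ _ card])
    have inv_step: "inv (insert b Q) \<longleftrightarrow> inv Q"
      if fin: "finite Q" and b: "Suc b \<in> insert q Q" "b \<notin> Q" "card (insert b Q) \<le> Suc K" for b Q
    proof (cases "c \<le> b")
      case True
      then have eq: "?far (insert b Q) = ?far Q" "?near (insert b Q) = insert b (?near Q)" by auto
      show ?thesis
      proof (cases "?far Q = {}")
        case False
        then have "card (?far (insert b Q)) > 0"
          using fin eq by (simp add: card_gt_0_iff)
        then have "card (?near (insert b Q)) \<le> K"
          using card_split[of "insert b Q"] fin b(3) by simp
        then have "peb_step K q (?near Q) (?near (insert b Q))"
          unfolding eq using b True by (intro peb_step.place) auto
        then have "pebbles K q N (?near Q) \<longleftrightarrow> pebbles K q N (?near (insert b Q))" for N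
          using peb_step_sym by (meson rtranclp.rtrancl_into_rtrancl)
        then show ?thesis by (simp add: inv_def eq(1))
      qed (simp add: inv_def eq)
    next
      case False
      then have eq: "?far (insert b Q) = insert b (?far Q)" "?near (insert b Q) = ?near Q" by auto
      \<comment> \<open>The first far pebble can only be placed or removed at the predecessor of
        \<open>c\<close> while \<open>c\<close> is pebbled, so the near part is its own witness
        \<open>N\<close>.\<close>
      have *: "inv Q \<longleftrightarrow> (\<exists>N. c \<in> N \<and> pebbles K q N (?near Q) \<and> pebbles K c {} (?far Q))"
        if "inv Q \<or> inv (insert b Q)"
      proof (cases "?far Q = {}")
        case True
        then have "Suc b = c" using b(1) False \<open>c < q\<close> by (auto intro: antisym)
        then have "c \<in> ?near Q" using b(1) q by auto
        then have "\<exists>N. c \<in> N \<and> pebbles K q N (?near Q)"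
          by (rule_tac exI[of _ "?near Q"]) simp
        with True show ?thesis by (simp add: inv_def)
      qed (auto simp: inv_def)
      show ?thesis
      proof (cases "?near Q = {}")
        case True
        then have "Suc b < c" using b(1) False \<open>c < q\<close>
          by (metis Int_iff atLeast_iff emptyE insertE not_less_eq linorder_not_less)
        then have "?far Q \<noteq> {}" using b(1) q by auto
        then show ?thesis using near_ne[of _ Q] True by (auto simp: inv_def eq)
      next
        case False
        then have "card (?near (insert b Q)) > 0"
          using fin eq by (simp add: card_gt_0_iff)
        then have "card (?far (insert b Q)) \<le> K"
          using card_split[of "insert b Q"] fin b(3) by simp
        then have "peb_step K c (?far Q) (?far (insert b Q))"
          unfolding eq using b \<open>\<not> c \<le> b\<close> by (intro peb_step.place) (auto simp: q)
        then have "pebbles K c {} (?far Q) \<longleftrightarrow> pebbles K c {} (?far (insert b Q))"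
          using peb_step_sym by (meson rtranclp.rtrancl_into_rtrancl)
        then show ?thesis using * by (auto simp: inv_def eq)
      qed
    qed
    have "inv Q"
      using Suc.prems(1)
    proof (induction rule: rtranclp_induct)
      case base
      then show ?case by (simp add: inv_def)
    next
      case (step Q Q')
      then have "finite Q" "finite Q'"
        using pebbles_finite[of "Suc K" q] by (auto intro: rtranclp.rtrancl_into_rtrancl)
      from step(2) show ?case
        by cases (use inv_step step.IH \<open>finite Q\<close> \<open>finite Q'\<close> in simp_all)
    qed
    show ?thesis
    proof (cases "c \<le> b")
      case False
      with Suc.prems(2) \<open>inv Q\<close> have "pebbles K c {} (?far Q)" "b \<in> ?far Q"
        by (auto simp: inv_def)
      from Suc.IH[OF this] q show ?thesis by simp
    next
      case True
      have "c + 2 ^ K < b + 2 ^ K + (2 ^ K :: nat)"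
        using True by (intro add_le_less_mono[of "c + 2 ^ K" _ 0, simplified]) auto
      with q show ?thesis by simp
    qed
  qed
qed

definition pebbled :: "nat \<Rightarrow> nat \<Rightarrow> nat set \<Rightarrow> 'a::field" where
  "pebbled K q Q = of_bool (pebbles K q {} Q)"

lemma pebbled_empty [simp]: "pebbled K q {} = 1"
  by (simp add: pebbled_def)

text \<open>Legal moves are reversible, so both configurations are reachable or neither is.\<close>

lemma pebbled_insert:
  assumes "Suc b \<in> insert q Q" "card (insert b Q) \<le> K"
  shows "pebbled K q (insert b Q) = pebbled K q Q"
proof (cases "b \<in> Q")
  case False
  then have "peb_step K q Q (insert b Q)"
    using assms by (intro peb_step.place)
  then have "pebbles K q {} Q \<longleftrightarrow> pebbles K q {} (insert b Q)"
    using peb_step_sym by (meson rtranclp.rtrancl_into_rtrancl)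
  then show ?thesis by (simp add: pebbled_def)
qed (simp add: insert_absorb)

lemma pebbled_far:
  assumes "b \<in> Q" "b + 2 ^ K \<le> q"
  shows "pebbled K q Q = 0"
  using pebbles_close[of K q Q b] assms by (force simp: pebbled_def)

subsection \<open>Clauses falsified by exactly one assignment\<close>

text \<open>Its polynomial is the indicator function of the string \<open>z\<close> on
  \<open>B\<close>, since a falsified clause has value 1. Any Boolean condition on \<open>B\<close>
  becomes a set of such clauses.\<close>

definition box_clause :: "nat set \<Rightarrow> nat set \<Rightarrow> clause" where
  "box_clause B z = Neg ` z \<union> Pos ` (B - z)"

lemma finite_box_clause [simp]: "finite B \<Longrightarrow> z \<subseteq> B \<Longrightarrow> finite (box_clause B z)"
  by (auto simp: box_clause_def intro: finite_subset)

lemma lit_var_box_clause: "z \<subseteq> B \<Longrightarrow> lit_var ` box_clause B z = B"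
  by (force simp: box_clause_def image_Un image_image)

lemma box_clause_falsified_iff:
  assumes "z \<subseteq> B"
  shows "(\<exists>l\<in>box_clause B z. lit_true v l) \<longleftrightarrow> {x\<in>B. v x} \<noteq> z"
  using assms by (auto simp: box_clause_def bex_Un ball_Un)

lemma clause_poly_box_clause:
  assumes "finite B" "z \<subseteq> B"
  shows "clause_poly (box_clause B z) = (\<Prod>x\<in>z. Var x) * (\<Prod>x\<in>B - z. 1 - Var x)"
proof -
  have "finite z" using assms finite_subset by blast
  then show ?thesis
    unfolding clause_poly_def box_clause_def using assms
    by (subst prod.union_disjoint) (auto simp: prod.reindex inj_on_def)
qed

text \<open>The indicators of all strings form a partition of unity; a new variable splits each
  indicator by the factors \<open>1 - Var x\<close> and \<open>Var x\<close>.\<close>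

lemma sum_clause_poly_box_clause:
  assumes "finite B"
  shows "(\<Sum>z\<in>Pow B. clause_poly (box_clause B z) :: 'a::field polynomial) = 1"
  using assms
proof (induction B rule: finite_induct)
  case (insert x B)
  let ?p = "\<lambda>B z. clause_poly (box_clause B z) :: 'a polynomial"
  have *: "?p (insert x B) z = (1 - Var x) * ?p B z"
    "?p (insert x B) (insert x z) = Var x * ?p B z" if "z \<in> Pow B" for z
  proof -
    have "x \<notin> z" "finite z" "insert x B - z = insert x (B - z)"
      "insert x B - insert x z = B - z"
      using that insert.hyps by (auto intro: finite_subset)
    then show "?p (insert x B) z = (1 - Var x) * ?p B z"
      "?p (insert x B) (insert x z) = Var x * ?p B z"
      using that insert.hyps by (auto simp: clause_poly_box_clause subset_insertI2)
  qed
  have "inj_on (insert x) (Pow B)"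
    using insert.hyps by (intro inj_onI) (metis PowD insert_ident subsetD)
  moreover have "Pow B \<inter> insert x ` Pow B = {}"
    using insert.hyps by auto
  ultimately have "(\<Sum>z\<in>Pow (insert x B). ?p (insert x B) z) =
      (\<Sum>z\<in>Pow B. ?p (insert x B) z) + (\<Sum>z\<in>Pow B. ?p (insert x B) (insert x z))"
    unfolding Pow_insert using insert.hyps
    by (simp add: sum.union_disjoint sum.reindex)
  also have "\<dots> = (1 - Var x) * (\<Sum>z\<in>Pow B. ?p B z) + Var x * (\<Sum>z\<in>Pow B. ?p B z)"
    using * by (simp add: sum_distrib_left)
  finally show ?case
    by (simp add: insert.IH)
qed (simp add: clause_poly_def box_clause_def)

lemma clause_poly_box_clause_union:
  assumes "finite B" "finite B'" "B \<inter> B' = {}" "z \<subseteq> B" "z' \<subseteq> B'"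
  shows "(clause_poly (box_clause (B \<union> B') (z \<union> z')) :: 'a::field polynomial) =
    clause_poly (box_clause B z) * clause_poly (box_clause B' z')"
proof -
  have "box_clause (B \<union> B') (z \<union> z') = box_clause B z \<union> box_clause B' z'"
    using assms by (auto simp: box_clause_def)
  then show ?thesis
    unfolding clause_poly_def using assms
    by (subst prod.union_disjoint[symmetric]) (auto simp: box_clause_def finite_subset)
qed

subsection \<open>Construction of refutations\<close>

definition reach :: "calculus \<Rightarrow> cnf \<Rightarrow> nat \<Rightarrow> 'a::field config \<Rightarrow> 'a config \<Rightarrow> bool" where
  "reach S F s = (\<lambda>X Y. step S F X Y \<and> card (config_vars Y) \<le> s)\<^sup>*\<^sup>*"

lemma reach_trans: "reach S F s X Y \<Longrightarrow> reach S F s Y Z \<Longrightarrow> reach S F s X Z"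
  unfolding reach_def by (rule rtranclp_trans)

lemma reach_step: "step S F X Y \<Longrightarrow> card (config_vars Y) \<le> s \<Longrightarrow> reach S F s X Y"
  unfolding reach_def by blast

lemma config_vars_insert [simp]: "config_vars (insert p X) = poly_vars p \<union> config_vars X"
  by (simp add: config_vars_def)

lemma reach_refutation:
  assumes "reach S F s {} {1 :: 'a::field polynomial}"
  shows "\<exists>\<pi> :: 'a config list. is_refutation S F \<pi> \<and> refutation_vspace \<pi> \<le> s"
proof -
  have "\<exists>\<pi>. \<pi> \<noteq> [] \<and> hd \<pi> = {} \<and> last \<pi> = X \<and> successively (step S F) \<pi> \<and>
      (\<forall>Y\<in>set \<pi>. card (config_vars Y) \<le> s)" if "reach S F s {} X" for X :: "'a config"
    using that unfolding reach_def
  proof (induction rule: rtranclp_induct)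
    case base
    show ?case by (rule exI[of _ "[{}]"]) (simp add: config_vars_def)
  next
    case (step Y Z)
    then obtain \<pi> where "\<pi> \<noteq> []" "hd \<pi> = {}" "last \<pi> = Y" "successively (step S F) \<pi>"
      "\<forall>Y\<in>set \<pi>. card (config_vars Y) \<le> s" by blast
    with step show ?case
      by (intro exI[of _ "\<pi> @ [Z]"]) (auto simp: successively_append_iff)
  qed
  from this[OF assms] obtain \<pi> :: "'a config list" where
    "\<pi> \<noteq> []" "hd \<pi> = {}" "last \<pi> = {1}" "successively (step S F) \<pi>"
    "\<forall>Y\<in>set \<pi>. card (config_vars Y) \<le> s" by blast
  then have \<pi>: "is_refutation S F \<pi>" "\<forall>Y\<in>set \<pi>. card (config_vars Y) \<le> s" "\<pi> \<noteq> []"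
    by (simp_all add: is_refutation_def)
  then have "refutation_vspace \<pi> \<le> s"
    unfolding refutation_vspace_def by (subst Max_le_iff) auto
  with \<pi> show ?thesis by blast
qed

lemma VSpace_le:
  assumes "is_refutation S F (\<pi> :: 'a::field config list)"
  shows "VSpace TYPE('a) S F \<le> refutation_vspace \<pi>"
  unfolding VSpace_def using assms by (intro cInf_lower) auto

locale var_bound =
  fixes S :: calculus and F :: cnf and s :: nat and V :: "nat set"
  assumes V: "finite V" "card V \<le> s" "V \<subseteq> cnf_vars F"
begin

text \<open>Quantifying over all larger \<open>X\<close> lets derivations run one after another
  without erasing anything. This is free of charge because only the variables in \<open>V\<close>
  are counted.\<close>

definition derivable :: "'a::field config \<Rightarrow> 'a polynomial \<Rightarrow> bool" where
  "derivable C p \<longleftrightarrow> (\<forall>X. finite X \<and> C \<subseteq> X \<and> config_vars X \<subseteq> V \<longrightarrow>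
     (\<exists>Y. finite Y \<and> insert p X \<subseteq> Y \<and> config_vars Y \<subseteq> V \<and> reach S F s X Y))"

lemma reach_within: "step S F X Y \<Longrightarrow> config_vars Y \<subseteq> V \<Longrightarrow> reach S F s X Y"
  by (rule reach_step) (use V card_mono[of V "config_vars Y"] in linarith)+

lemma derivable_mem: "p \<in> C \<Longrightarrow> derivable C p"
  unfolding derivable_def reach_def by blast

lemma derivable_axiom:
  assumes "a \<in> axioms_of F" "poly_vars a \<subseteq> V"
  shows "derivable C a"
  unfolding derivable_def
proof (intro allI impI)
  fix X assume "finite X \<and> C \<subseteq> X \<and> config_vars X \<subseteq> V"
  with assms show "\<exists>Y. finite Y \<and> insert a X \<subseteq> Y \<and> config_vars Y \<subseteq> V \<and> reach S F s X Y"
    by (intro exI[of _ "insert a X"]) (auto intro!: reach_within step.download)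
qed

lemma derivable_inferred:
  assumes der: "\<And>p. p \<in> P \<Longrightarrow> derivable C p" and "finite P"
    and inf: "\<And>X. P \<subseteq> X \<Longrightarrow> inferred S F X r" and r: "poly_vars r \<subseteq> V"
  shows "derivable C r"
  unfolding derivable_def
proof (intro allI impI)
  fix X assume X: "finite X \<and> C \<subseteq> X \<and> config_vars X \<subseteq> V"
  have "\<exists>Y. finite Y \<and> P \<union> X \<subseteq> Y \<and> config_vars Y \<subseteq> V \<and> reach S F s X Y"
    using \<open>finite P\<close> der
  proof (induction P rule: finite_induct)
    case empty
    with X show ?case by (auto simp: reach_def)
  next
    case (insert p P)
    then obtain Y where Y: "finite Y" "P \<union> X \<subseteq> Y" "config_vars Y \<subseteq> V" "reach S F s X Y"
      by auto
    moreover have "derivable C p" using insert.prems by simp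
    ultimately obtain Z where "finite Z" "insert p Y \<subseteq> Z" "config_vars Z \<subseteq> V" "reach S F s Y Z"
      using X unfolding derivable_def by (meson Un_subset_iff order_trans)
    with Y show ?case
      by (intro exI[of _ Z]) (auto intro: reach_trans)
  qed
  then obtain Y where Y: "finite Y" "P \<union> X \<subseteq> Y" "config_vars Y \<subseteq> V" "reach S F s X Y"
    by blast
  then have "reach S F s Y (insert r Y)"
    using r inf[of Y] by (intro reach_within step.inference) auto
  with Y r show "\<exists>Y. finite Y \<and> insert r X \<subseteq> Y \<and> config_vars Y \<subseteq> V \<and> reach S F s X Y"
    by (intro exI[of _ "insert r Y"]) (auto intro: reach_trans)
qed

lemma derivable_lin:
  assumes "derivable C p" "derivable C q" "poly_vars p \<subseteq> V" "poly_vars q \<subseteq> V"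
  shows "derivable C (Const \<alpha> * p + Const \<beta> * q)"
proof (rule derivable_inferred[of "{p, q}"])
  show "poly_vars (Const \<alpha> * p + Const \<beta> * q) \<subseteq> V"
    by (intro order_trans[OF poly_vars_add] Un_least order_trans[OF poly_vars_mult])
      (use assms(3,4) in auto)
qed (use assms in \<open>auto intro: inferred.linear_combination\<close>)

lemma derivable_Var_mult:
  assumes "derivable C p" "poly_vars p \<subseteq> V" "x \<in> V" "mult_allowed S F p"
  shows "derivable C (Var x * p)"
proof (rule derivable_inferred[of "{p}"])
  show "poly_vars (Var x * p) \<subseteq> V"
    using assms poly_vars_mult[of "Var x" p] by auto
qed (use assms V in \<open>auto intro!: inferred.multiplication\<close>)

lemma Const_0 [simp]: "Const 0 = 0" and Const_1 [simp]: "Const 1 = 1"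
  by (simp_all add: Const_def)

lemma derivable_sum:
  assumes "derivable C (0 :: 'a::field polynomial)" "\<And>i. i \<in> I \<Longrightarrow> derivable C (f i)"
    "\<And>i. i \<in> I \<Longrightarrow> poly_vars (f i) \<subseteq> V"
  shows "derivable C (\<Sum>i\<in>I. f i :: 'a polynomial) \<and> poly_vars (\<Sum>i\<in>I. f i) \<subseteq> V"
  using assms(2,3)
proof (induction I rule: infinite_finite_induct)
  case (insert i I)
  then have IH: "derivable C (sum f I)" "poly_vars (sum f I) \<subseteq> V"
      "derivable C (f i)" "poly_vars (f i) \<subseteq> V" by auto
  moreover have "poly_vars (f i + sum f I) \<subseteq> V"
    using IH by (intro order_trans[OF poly_vars_add] Un_least)
  ultimately show ?case
    using insert.hyps derivable_lin[of C "f i" "sum f I" 1 1] by simp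
qed (use assms(1) in auto)

text \<open>The factor \<open>p\<close> is split into monomials, each multiplied up one variable at
  a time; \<open>mult\<close> permits the intermediate products. It holds for every \<open>a\<close>
  in PC, and for axioms \<open>a\<close> in MC.\<close>

lemma derivable_mult:
  assumes a: "derivable C a" "poly_vars a \<subseteq> V" and p: "poly_vars p \<subseteq> V"
    and mult: "\<And>m. mult_allowed S F (Poly_Mapping.single m 1 * a)"
  shows "derivable C (p * a)"
proof -
  have pow: "derivable C (Poly_Mapping.single m 1 * a) \<and>
      poly_vars (Poly_Mapping.single m 1 * a) \<subseteq> V" if "Poly_Mapping.keys m \<subseteq> V" for m
    using that
  proof (induction m rule: update_induct)
    case const
    with a show ?case by simp
  next
    case (update f x v)
    have f: "Poly_Mapping.keys f \<subseteq> V" "x \<in> V"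
      using update by (auto simp: keys_update)
    have upd: "Poly_Mapping.update x v f = f + Poly_Mapping.single x v"
      using update(1) by (intro poly_mapping_eqI)
        (auto simp: lookup_update lookup_add lookup_single when_def in_keys_iff)
    have "derivable C (Poly_Mapping.single (f + Poly_Mapping.single x n) 1 * a) \<and>
      poly_vars (Poly_Mapping.single (f + Poly_Mapping.single x n) 1 * a) \<subseteq> V" for n
    proof (induction n)
      case 0
      with update f show ?case by simp
    next
      case (Suc n)
      have eq: "Poly_Mapping.single (f + Poly_Mapping.single x (Suc n)) 1 * a =
          Var x * (Poly_Mapping.single (f + Poly_Mapping.single x n) 1 * a)"
        unfolding Var_def
        by (simp add: mult_single add_ac flip: mult.assoc single_add)
      show ?case
        unfolding eq using Suc f(2) mult poly_vars_mult[of "Var x"]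
        by (fastforce intro: derivable_Var_mult)
    qed
    then show ?case unfolding upd .
  qed
  have 0: "derivable C 0"
    using derivable_lin[OF a(1) a(1) a(2) a(2), of 0 0] by simp
  have eq: "p * a = (\<Sum>k\<in>Poly_Mapping.keys p. Const (Poly_Mapping.lookup p k) * (Poly_Mapping.single k 1 * a))"
    by (subst (1) polynomial_sum_single)
      (simp add: sum_distrib_right Const_def mult_single flip: mult.assoc)
  show ?thesis
    unfolding eq
  proof (rule derivable_sum[OF 0, THEN conjunct1])
    fix k assume "k \<in> Poly_Mapping.keys p"
    then have k: "Poly_Mapping.keys k \<subseteq> V" using p by (auto simp: poly_vars_def)
    show "derivable C (Const (Poly_Mapping.lookup p k) * (Poly_Mapping.single k 1 * a))"
      using derivable_lin[of C _ _ "Poly_Mapping.lookup p k" 0] pow[OF k] by fastforce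
    show "poly_vars (Const (Poly_Mapping.lookup p k) * (Poly_Mapping.single k 1 * a)) \<subseteq> V"
      using pow[OF k] poly_vars_mult[of "Const _" "Poly_Mapping.single k 1 * a"] by fastforce
  qed
qed

lemma reach_erase:
  assumes "finite X" "Y \<subseteq> X" "config_vars X \<subseteq> V"
  shows "reach S F s X Y"
proof -
  have "reach S F s (Y \<union> D) Y" if "finite D" "config_vars (Y \<union> D) \<subseteq> V" "D \<inter> Y = {}" for D
    using that
  proof (induction D rule: finite_induct)
    case empty
    then show ?case by (simp add: reach_def)
  next
    case (insert p D)
    then have "Y \<union> insert p D - {p} = Y \<union> D" by auto
    then have "step S F (Y \<union> insert p D) (Y \<union> D)"
      using step.erasure[of p "Y \<union> insert p D" S F] by simp
    moreover have "config_vars (Y \<union> D) \<subseteq> V"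
      using insert by (auto simp: config_vars_def)
    ultimately show ?case
      using reach_within reach_trans insert by blast
  qed
  moreover have "Y \<union> (X - Y) = X" using assms(2) by auto
  ultimately show ?thesis using assms by (metis Diff_disjoint finite_Diff inf_commute)
qed

lemma reach_derivable:
  assumes "finite C" "config_vars C \<subseteq> V" "finite D" "\<And>p. p \<in> D \<Longrightarrow> derivable C p"
  shows "reach S F s C D"
proof -
  have "\<exists>Y. finite Y \<and> D \<union> C \<subseteq> Y \<and> config_vars Y \<subseteq> V \<and> reach S F s C Y"
    using assms(3,4)
  proof (induction D rule: finite_induct)
    case empty
    with assms show ?case by (auto simp: reach_def)
  next
    case (insert p D)
    then obtain Y where Y: "finite Y" "D \<union> C \<subseteq> Y" "config_vars Y \<subseteq> V" "reach S F s C Y"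
      by auto
    moreover have "derivable C p" using insert.prems by simp
    ultimately obtain Z where "finite Z" "insert p Y \<subseteq> Z" "config_vars Z \<subseteq> V" "reach S F s Y Z"
      unfolding derivable_def by (meson Un_subset_iff order_trans)
    with Y show ?case
      by (intro exI[of _ Z]) (auto intro: reach_trans)
  qed
  then obtain Y where Y: "finite Y" "D \<union> C \<subseteq> Y" "config_vars Y \<subseteq> V" "reach S F s C Y"
    by blast
  then have "reach S F s Y D" by (intro reach_erase) auto
  with Y(4) show ?thesis by (rule reach_trans)
qed

end

text \<open>Completeness of both systems; without a refutation \<open>VSpace\<close> would be 0 and
  the lower bound would fail. For each assignment, the full clause over all variables is a multiple
  of a falsified clause, and all full clauses sum to 1.\<close>

lemma refutation_exists:
  assumes F: "is_cnf F" "unsatisfiable F"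
  shows "\<exists>\<pi> :: 'a::field config list. is_refutation S F \<pi>"
proof -
  define V where "V = cnf_vars F"
  have "finite V"
    using F by (auto simp: V_def cnf_vars_def is_cnf_def)
  interpret var_bound S F "card V" V
    by unfold_locales (use \<open>finite V\<close> in \<open>auto simp: V_def\<close>)
  have cl: "derivable {} (clause_poly C :: 'a polynomial)"
    "poly_vars (clause_poly C :: 'a polynomial) \<subseteq> V" if "C \<in> F" for C
  proof -
    show "poly_vars (clause_poly C :: 'a polynomial) \<subseteq> V"
      by (rule order_trans[OF poly_vars_clause_poly_subset])
        (use that in \<open>auto simp: V_def cnf_vars_def\<close>)
    then show "derivable {} (clause_poly C :: 'a polynomial)"
      using that by (intro derivable_axiom) (auto simp: axioms_of_def)
  qed
  have mult: "mult_allowed S F (Poly_Mapping.single m 1 * clause_poly C :: 'a polynomial)"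
    if "C \<in> F" for m C
  proof (cases S)
    case MC
    have "clause_poly C \<in> axioms_of F" "is_monomial (Poly_Mapping.single m 1 :: 'a polynomial)"
      using that by (auto simp: axioms_of_def is_monomial_def)
    with MC show ?thesis by (simp only: mult_allowed.simps) blast
  qed simp
  have box: "derivable {} (clause_poly (box_clause V z) :: 'a polynomial)" if "z \<subseteq> V" for z
  proof -
    obtain C where C: "C \<in> F" "\<forall>l\<in>C. \<not> lit_true (\<lambda>x. x \<in> z) l"
      using F by (auto simp: unsatisfiable_def)
    have "C \<subseteq> box_clause V z"
    proof
      fix l assume "l \<in> C"
      with C have "lit_var l \<in> V" "\<not> lit_true (\<lambda>x. x \<in> z) l"
        by (auto simp: V_def cnf_vars_def)
      then show "l \<in> box_clause V z" by (cases l) (auto simp: box_clause_def)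
    qed
    then have eq: "(clause_poly (box_clause V z) :: 'a polynomial) =
        clause_poly (box_clause V z - C) * clause_poly C"
      unfolding clause_poly_def using \<open>finite V\<close> that by (intro prod.subset_diff) auto
    have "lit_var ` (box_clause V z - C) \<subseteq> V"
      using lit_var_box_clause[OF that] by blast
    then have "poly_vars (clause_poly (box_clause V z - C) :: 'a polynomial) \<subseteq> V"
      by (rule order_trans[OF poly_vars_clause_poly_subset])
    then show ?thesis
      unfolding eq using cl C(1) mult by (intro derivable_mult) auto
  qed
  have "derivable {} (0 :: 'a polynomial)"
  proof -
    obtain C where "C \<in> F" using F by (auto simp: unsatisfiable_def)
    from derivable_lin[OF cl(1)[OF this] cl(1)[OF this] cl(2)[OF this] cl(2)[OF this], of 0 0]
    show ?thesis by simp
  qed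
  moreover have "poly_vars (clause_poly (box_clause V z) :: 'a polynomial) \<subseteq> V" if "z \<subseteq> V" for z
    by (rule order_trans[OF poly_vars_clause_poly_subset]) (simp add: lit_var_box_clause that)
  ultimately have "derivable {} (\<Sum>z\<in>Pow V. clause_poly (box_clause V z) :: 'a polynomial)"
    using box by (intro derivable_sum[THEN conjunct1]) auto
  then have "derivable {} (1 :: 'a polynomial)"
    using \<open>finite V\<close> by (simp add: sum_clause_poly_box_clause)
  then have "reach S F (card V) {} {1 :: 'a polynomial}"
    by (intro reach_derivable) (auto simp: config_vars_def)
  then show ?thesis using reach_refutation by blast
qed

subsection \<open>The chain formulas\<close>

definition blk :: "nat \<Rightarrow> nat \<Rightarrow> nat set" where
  "blk d b = {b * (5 * d)..<Suc b * (5 * d)}"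

text \<open>
  In a cube of dimension \<open>d\<close> whose bottom has cardinality \<open>d\<close>, the bottom is the only good set,
  so that over every field good and bad are indistinguishable in degree less than \<open>d\<close>. Among large
  sets good and bad alternate.
\<close>

definition good :: "nat \<Rightarrow> nat set \<Rightarrow> bool" where
  "good d z \<longleftrightarrow> card z = d \<or> 2 * d < card z \<and> even (5 * d - card z)"

definition chain_link :: "nat \<Rightarrow> nat \<Rightarrow> nat set \<Rightarrow> bool" where
  "chain_link d b z \<longleftrightarrow> z \<subseteq> blk d b \<union> blk d (Suc b) \<and> good d (z \<inter> blk d b) \<and> \<not> good d (z \<inter> blk d (Suc b))"

definition chain_cnf :: "nat \<Rightarrow> nat \<Rightarrow> cnf" where
  "chain_cnf d M =
     box_clause (blk d 0) ` {z. z \<subseteq> blk d 0 \<and> \<not> good d z} \<union>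
     box_clause (blk d (Suc M)) ` {z. z \<subseteq> blk d (Suc M) \<and> good d z} \<union>
     (\<Union>b\<le>M. box_clause (blk d b \<union> blk d (Suc b)) ` {z. chain_link d b z})"

lemma finite_blk [simp]: "finite (blk d b)"
  by (simp add: blk_def)

lemma card_blk [simp]: "card (blk d b) = 5 * d"
  by (simp add: blk_def)

lemma blk_disjoint: "b \<noteq> c \<Longrightarrow> blk d b \<inter> blk d c = {}"
proof (induction b c rule: linorder_wlog)
  case (le b c)
  then have "Suc b * (5 * d) \<le> c * (5 * d)" by (intro mult_le_mono1) simp
  then show ?case by (auto simp: blk_def)
qed (metis inf_commute)

lemma is_cnf_chain_cnf: "is_cnf (chain_cnf d M)"
proof -
  have "finite {z. z \<subseteq> B \<and> P z}" if "finite B" for B and P :: "nat set \<Rightarrow> bool"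
    using that by (auto intro: finite_subset[of _ "Pow B"])
  then show ?thesis
    unfolding is_cnf_def chain_cnf_def chain_link_def by (auto simp del: box_clause_def)
qed

lemma unsatisfiable_chain_cnf: "unsatisfiable (chain_cnf d M)"
  unfolding unsatisfiable_def
proof
  assume "\<exists>v. \<forall>C\<in>chain_cnf d M. \<exists>l\<in>C. lit_true v l"
  then obtain v where v: "\<And>C. C \<in> chain_cnf d M \<Longrightarrow> \<exists>l\<in>C. lit_true v l" by blast
  define z where "z b = {x\<in>blk d b. v x}" for b
  have box: "box_clause B {x\<in>B. v x} \<notin> chain_cnf d M" for B
    using v[of "box_clause B {x\<in>B. v x}"] by (auto simp: box_clause_falsified_iff)
  have "good d (z b)" if "b \<le> Suc M" for b
    using that
  proof (induction b)
    case 0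
    then show ?case
      using box[of "blk d 0"] unfolding chain_cnf_def z_def by blast
  next
    case (Suc b)
    let ?B = "blk d b \<union> blk d (Suc b)"
    have "{x\<in>?B. v x} \<inter> blk d b = z b" "{x\<in>?B. v x} \<inter> blk d (Suc b) = z (Suc b)"
      by (auto simp: z_def)
    moreover have "\<not> chain_link d b {x\<in>?B. v x}"
      using box[of ?B] Suc.prems unfolding chain_cnf_def by blast
    ultimately show ?case
      using Suc by (auto simp: chain_link_def)
  qed
  then show False
    using box[of "blk d (Suc M)"] unfolding chain_cnf_def z_def by blast
qed

lemma good_subset_exists:
  assumes "0 < d"
  obtains z z' where "z \<subseteq> blk d b" "good d z" "z' \<subseteq> blk d b" "\<not> good d z'"
proof -
  obtain z where "z \<subseteq> blk d b" "card z = d"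
    using obtain_subset_with_card_n[of d "blk d b"] by auto
  with assms that[of z "{}"] show ?thesis by (auto simp: good_def)
qed

lemma chain_link_union:
  assumes "z \<subseteq> blk d b" "good d z" "z' \<subseteq> blk d (Suc b)" "\<not> good d z'"
  shows "chain_link d b (z \<union> z')"
proof -
  have "(z \<union> z') \<inter> blk d b = z" "(z \<union> z') \<inter> blk d (Suc b) = z'"
    using assms blk_disjoint[of b "Suc b" d] by auto
  with assms show ?thesis by (auto simp: chain_link_def)
qed

lemma cnf_vars_chain_cnf:
  assumes "0 < d"
  shows "cnf_vars (chain_cnf d M) = (\<Union>b\<le>Suc M. blk d b)"
proof (intro equalityI subsetI)
  fix x assume "x \<in> cnf_vars (chain_cnf d M)"
  then obtain C where C: "C \<in> chain_cnf d M" "x \<in> lit_var ` C"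
    unfolding cnf_vars_def by blast
  then consider z where "z \<subseteq> blk d 0" "C = box_clause (blk d 0) z"
    | z where "z \<subseteq> blk d (Suc M)" "C = box_clause (blk d (Suc M)) z"
    | b z where "b \<le> M" "chain_link d b z" "C = box_clause (blk d b \<union> blk d (Suc b)) z"
    unfolding chain_cnf_def by blast
  then show "x \<in> (\<Union>b\<le>Suc M. blk d b)"
  proof cases
    case 3
    then have "x \<in> blk d b \<union> blk d (Suc b)"
      using C(2) by (simp add: chain_link_def lit_var_box_clause)
    with 3(1) show ?thesis by (auto intro: bexI[of _ "Suc b"] bexI[of _ b])
  qed (use C(2) in \<open>auto simp: lit_var_box_clause\<close>)
next
  fix x assume "x \<in> (\<Union>b\<le>Suc M. blk d b)"
  then have "x \<in> blk d 0 \<or> (\<exists>b\<le>M. x \<in> blk d (Suc b))"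
    by (metis UN_E atMost_iff not0_implies_Suc Suc_le_mono)
  then obtain b where b: "b \<le> M" "x \<in> blk d b \<union> blk d (Suc b)" by blast
  obtain z where z: "z \<subseteq> blk d b" "good d z"
    using good_subset_exists[OF assms] by metis
  obtain z' where z': "z' \<subseteq> blk d (Suc b)" "\<not> good d z'"
    using good_subset_exists[OF assms] by metis
  have "box_clause (blk d b \<union> blk d (Suc b)) (z \<union> z') \<in> chain_cnf d M"
    using b chain_link_union[OF z z'] unfolding chain_cnf_def by blast
  moreover have "x \<in> lit_var ` box_clause (blk d b \<union> blk d (Suc b)) (z \<union> z')"
    using b z z' by (subst lit_var_box_clause) auto
  ultimately show "x \<in> cnf_vars (chain_cnf d M)"
    unfolding cnf_vars_def by blast
qed

section \<open>Upper bounds on the number of variables and on the space of PC\<close>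

lemma card_cnf_vars_chain_cnf:
  assumes "0 < d"
  shows "card (cnf_vars (chain_cnf d M)) \<le> (M + 2) * (5 * d)"
proof -
  have "card (\<Union>b\<le>Suc M. blk d b) \<le> (\<Sum>b\<le>Suc M. card (blk d b))"
    by (rule card_UN_le) simp
  then show ?thesis by (simp add: cnf_vars_chain_cnf[OF assms])
qed

text \<open>The configuration \<open>bad b\<close> says that all indicators of bad strings vanish,
  so that block \<open>b\<close> is good. It is turned into \<open>bad (Suc b)\<close> within two
  blocks, that is, \<open>10 * d\<close> variables.\<close>

lemma PC_VSpace_chain_cnf:
  assumes "0 < d"
  shows "VSpace TYPE('a::field) PC (chain_cnf d M) \<le> 10 * d"
proof -
  let ?F = "chain_cnf d M" and ?s = "10 * d"
  let ?p = "\<lambda>b z. clause_poly (box_clause (blk d b) z) :: 'a polynomial"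
  define bad where "bad b = ?p b ` {z. z \<subseteq> blk d b \<and> \<not> good d z}" for b
  have vb: "var_bound ?F ?s V" if "V \<subseteq> cnf_vars ?F" "finite V" "card V \<le> 10 * d" for V
    using that by unfold_locales auto
  have fin: "finite {z. z \<subseteq> blk d b \<and> P z}" for b and P :: "nat set \<Rightarrow> bool"
    by (auto intro: finite_subset[of _ "Pow (blk d b)"])
  then have fin_bad: "finite (bad b)" for b by (simp add: bad_def)
  have vars: "poly_vars (?p b z) \<subseteq> blk d b" if "z \<subseteq> blk d b" for b z
    by (rule order_trans[OF poly_vars_clause_poly_subset]) (simp add: lit_var_box_clause that)
  then have vars_bad: "config_vars (bad b) \<subseteq> blk d b" for b
    by (auto simp: config_vars_def bad_def)
  have blk_vars: "blk d b \<subseteq> cnf_vars ?F" if "b \<le> Suc M" for b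
    using that by (auto simp: cnf_vars_chain_cnf[OF assms])
  have "reach PC ?F ?s {} (bad b)" if "b \<le> Suc M" for b
    using that
  proof (induction b)
    case 0
    interpret var_bound PC ?F ?s "blk d 0"
      by (rule vb) (use blk_vars[of 0] in auto)
    have "derivable {} p" if "p \<in> bad 0" for p
      using that vars_bad[of 0]
      by (intro derivable_axiom) (auto simp: bad_def axioms_of_def chain_cnf_def config_vars_def)
    then show ?case
      by (intro reach_derivable fin_bad) (auto simp: config_vars_def)
  next
    case (Suc b)
    let ?V = "blk d b \<union> blk d (Suc b)"
    interpret var_bound PC ?F ?s ?V
      by (rule vb) (use blk_vars[of b] blk_vars[of "Suc b"] Suc.prems card_Un_le[of "blk d b" "blk d (Suc b)"] in auto)
    have "derivable (bad b) (?p (Suc b) z')" if z': "z' \<subseteq> blk d (Suc b)" "\<not> good d z'" for z'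
    proof -
      \<comment> \<open>The indicator of \<open>z'\<close> is the sum of its products with all
        indicators on block \<open>b\<close>. Such a product is an axiom for good \<open>z\<close>
        and a multiple of a member of \<open>bad b\<close> otherwise; the latter uses the
        unrestricted multiplication of PC.\<close>
      have *: "derivable (bad b) (?p (Suc b) z' * ?p b z) \<and> poly_vars (?p (Suc b) z' * ?p b z) \<subseteq> ?V"
        if z: "z \<subseteq> blk d b" for z
      proof
        show V: "poly_vars (?p (Suc b) z' * ?p b z) \<subseteq> ?V"
          by (intro order_trans[OF poly_vars_mult]) (use vars[OF z] vars[OF z'(1)] in auto)
        show "derivable (bad b) (?p (Suc b) z' * ?p b z)"
        proof (cases "good d z")
          case True
          have eq: "?p (Suc b) z' * ?p b z = clause_poly (box_clause ?V (z \<union> z'))"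
            using z z' blk_disjoint[of b "Suc b" d]
            by (subst clause_poly_box_clause_union) (auto simp: mult.commute)
          have "box_clause ?V (z \<union> z') \<in> ?F"
            using chain_link_union[OF z True z'] Suc.prems unfolding chain_cnf_def by auto
          then show ?thesis
            using V unfolding eq axioms_of_def by (intro derivable_axiom) (auto simp: axioms_of_def)
        next
          case False
          then have "?p b z \<in> bad b" using z by (auto simp: bad_def)
          then show ?thesis
            using vars[OF z] vars[OF z'(1)] by (intro derivable_mult derivable_mem) auto
        qed
      qed
      have "derivable (bad b) (0 :: 'a polynomial)"
        using derivable_lin[of "bad b" "?p (Suc b) z' * ?p b {}" "?p (Suc b) z' * ?p b {}" 0 0] *[of "{}"]
        by simp
      then have "derivable (bad b) (\<Sum>z\<in>Pow (blk d b). ?p (Suc b) z' * ?p b z)"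
        using * by (intro derivable_sum[THEN conjunct1]) auto
      then show ?thesis
        by (simp add: sum_clause_poly_box_clause flip: sum_distrib_left)
    qed
    then have "reach PC ?F ?s (bad b) (bad (Suc b))"
      using vars_bad[of b] by (intro reach_derivable fin_bad) (auto simp: bad_def[of "Suc b"])
    with Suc show ?case using reach_trans by force
  qed
  moreover have "reach PC ?F ?s (bad (Suc M)) {1}"
  proof -
    interpret var_bound PC ?F ?s "blk d (Suc M)"
      by (rule vb) (use blk_vars[of "Suc M"] in auto)
    \<comment> \<open>On the last block the good strings are axioms and the bad ones have been
      derived, so all indicators are present and sum to 1.\<close>
    have *: "derivable (bad (Suc M)) (?p (Suc M) z)" if z: "z \<subseteq> blk d (Suc M)" for z
    proof (cases "good d z")
      case True
      then show ?thesis
        using z vars[OF z] by (intro derivable_axiom) (auto simp: axioms_of_def chain_cnf_def)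
    next
      case False
      then show ?thesis using z by (intro derivable_mem) (auto simp: bad_def)
    qed
    have "derivable (bad (Suc M)) (0 :: 'a polynomial)"
      using derivable_lin[of "bad (Suc M)" "?p (Suc M) {}" "?p (Suc M) {}" 0 0] *[of "{}"] vars[of "{}" "Suc M"]
      by simp
    then have "derivable (bad (Suc M)) (\<Sum>z\<in>Pow (blk d (Suc M)). ?p (Suc M) z)"
      using * vars by (intro derivable_sum[THEN conjunct1]) auto
    then have "derivable (bad (Suc M)) (1 :: 'a polynomial)"
      by (simp add: sum_clause_poly_box_clause)
    then show ?thesis
      using vars_bad[of "Suc M"] by (intro reach_derivable fin_bad) auto
  qed
  ultimately have "reach PC ?F ?s {} {1 :: 'a polynomial}"
    using reach_trans by blast
  then obtain \<pi> :: "'a config list" where "is_refutation PC ?F \<pi>" "refutation_vspace \<pi> \<le> ?s"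
    using reach_refutation by blast
  then show ?thesis using VSpace_le[of PC ?F \<pi>] by simp
qed

subsection \<open>Functionals on clause polynomials\<close>

text \<open>One literal suffices: its factor replaces \<open>e\<close> by
  \<open>X \<mapsto> e (insert x X)\<close>, or by the difference of \<open>e\<close> and this
  function, which vanishes by hypothesis.\<close>

lemma lfun_clause_poly_eq_0:
  assumes C: "finite C" "l \<in> C"
    and e: "\<And>X. X \<subseteq> lit_var ` C \<Longrightarrow> (case l of Neg x \<Rightarrow> e (insert x X) = 0 | Pos x \<Rightarrow> e (insert x X) = e X)"
  shows "lfun e (clause_poly C) = 0"
proof -
  let ?p = "clause_poly (C - {l})"
  have eq: "clause_poly C = lit_poly l * ?p"
    unfolding clause_poly_def using C by (rule prod.remove)
  have e': "case l of Neg x \<Rightarrow> e (insert x X) = 0 | Pos x \<Rightarrow> e (insert x X) = e X" if "X \<subseteq> poly_vars ?p" for X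
    using that poly_vars_clause_poly_subset[of "C - {l}"] by (intro e) blast
  show ?thesis
  proof (cases l)
    case (Pos x)
    then have "lfun e (clause_poly C) = lfun e ?p - lfun (\<lambda>X. e (insert x X)) ?p"
      unfolding eq by (simp add: left_diff_distrib lfun_diff)
    also have "lfun (\<lambda>X. e (insert x X)) ?p = lfun e ?p"
      by (rule lfun_cong) (use e' Pos in simp)
    finally show ?thesis by simp
  next
    case (Neg x)
    then have "lfun e (clause_poly C) = lfun (\<lambda>X. e (insert x X)) ?p"
      unfolding eq by simp
    also have "\<dots> = lfun (\<lambda>X. 0) ?p"
      by (rule lfun_cong) (use e' Neg in simp)
    finally show ?thesis by simp
  qed
qed

text \<open>On \<open>D\<close> the functional is evaluation at \<open>y\<close>. A variable where
  \<open>y\<close> and \<open>z\<close> differ gives a literal of the clause that \<open>y\<close>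
  satisfies.\<close>

lemma lfun_box_clause_eq_0:
  assumes B: "finite B" "z \<subseteq> B" "D \<subseteq> B" and ne: "y \<inter> D \<noteq> z \<inter> D"
    and e: "\<And>X. X \<subseteq> B \<Longrightarrow> e X = of_bool (X \<inter> D \<subseteq> y) * h (X - D)"
  shows "lfun e (clause_poly (box_clause B z)) = 0"
proof -
  obtain x where x: "x \<in> D" "x \<in> y \<longleftrightarrow> x \<notin> z" using ne by blast
  define l where "l = (if x \<in> z then Neg x else Pos x)"
  have ins: "insert x X - D = X - D" "insert x X \<inter> D = insert x (X \<inter> D)" for X
    using x(1) by auto
  have "case l of Neg x \<Rightarrow> e (insert x X) = 0 | Pos x \<Rightarrow> e (insert x X) = e X" if "X \<subseteq> B" for X
  proof -
    have "insert x X \<subseteq> B" using that x(1) B(3) by auto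
    from e[OF this] have "e (insert x X) = of_bool (x \<in> y \<and> X \<inter> D \<subseteq> y) * h (X - D)"
      by (simp add: ins)
    then show ?thesis
      using e[OF that] x(2) by (simp add: l_def)
  qed
  moreover have "l \<in> box_clause B z"
    using x(1) B(3) by (auto simp: l_def box_clause_def)
  ultimately show ?thesis
    using B by (intro lfun_clause_poly_eq_0[of _ l]) (simp_all add: lit_var_box_clause)
qed

lemma lfun_eval_box_clause:
  assumes "finite B" "z \<subseteq> B"
  shows "lfun (\<lambda>X. of_bool (X \<subseteq> z)) (clause_poly (box_clause B z) :: 'a::field polynomial) = 1"
proof -
  have V: "lfun (\<lambda>X. of_bool (X \<subseteq> z)) (Var x * p) = of_bool (x \<in> z) * lfun (\<lambda>X. of_bool (X \<subseteq> z)) p"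
    for x and p :: "'a polynomial"
    by (simp flip: lfun_cmult_fun add: of_bool_conj)
  have "lfun (\<lambda>X. of_bool (X \<subseteq> z)) (clause_poly C :: 'a polynomial) = 1"
    if "finite C" "C \<subseteq> box_clause B z" for C
    using that
  proof (induction C rule: finite_induct)
    case empty
    then show ?case by (simp add: clause_poly_def flip: single_one)
  next
    case (insert l C)
    have "clause_poly (insert l C) = (lit_poly l * clause_poly C :: 'a polynomial)"
      unfolding clause_poly_def using insert.hyps by simp
    with insert show ?case
      by (auto simp: box_clause_def left_diff_distrib lfun_diff V)
  qed
  then show ?thesis using assms by simp
qed

lemma poly_vars_clause_poly_box_clause:
  assumes "finite B" "z \<subseteq> B"
  shows "poly_vars (clause_poly (box_clause B z) :: 'a::field polynomial) = B"
proof (intro equalityI subsetI)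
  fix x assume "x \<in> poly_vars (clause_poly (box_clause B z) :: 'a polynomial)"
  then show "x \<in> B"
    using poly_vars_clause_poly_subset[of "box_clause B z"] lit_var_box_clause[OF assms(2)] by blast
next
  fix x assume x: "x \<in> B"
  let ?p = "clause_poly (box_clause B z) :: 'a polynomial"
  \<comment> \<open>Flipping \<open>x\<close> changes the value of the indicator from 1 to 0, which
    is impossible if \<open>x\<close> does not occur.\<close>
  define y where "y = (if x \<in> z then z - {x} else insert x z)"
  show "x \<in> poly_vars ?p"
  proof (rule ccontr)
    assume "x \<notin> poly_vars ?p"
    then have "lfun (\<lambda>X. of_bool (X \<subseteq> z)) ?p = lfun (\<lambda>X. of_bool (X \<subseteq> y)) ?p"
      by (intro lfun_cong) (auto simp: y_def)
    also have "\<dots> = 0"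
      using assms x by (intro lfun_box_clause_eq_0[of B z B y _ "\<lambda>_. 1"]) (auto simp: y_def)
    finally show False using lfun_eval_box_clause[OF assms, where 'a='a] by simp
  qed
qed

lemma clause_poly_box_clause_nonzero:
  assumes "finite B" "z \<subseteq> B"
  shows "clause_poly (box_clause B z) \<noteq> (0 :: 'a::field polynomial)"
  using lfun_eval_box_clause[OF assms, where 'a='a] by auto

text \<open>Inclusion-exclusion. It writes the indicator of \<open>A = J\<close> as a signed sum of
  tests \<open>A \<subseteq> V\<close>, which are evaluations.\<close>

lemma alternating_sum_supersets:
  assumes "finite J"
  shows "(\<Sum>V\<in>Pow J. (-1) ^ card V * of_bool (A \<subseteq> V)) = ((-1) ^ card J * of_bool (A = J) :: 'a::comm_ring_1)"
  using assms
proof (induction J arbitrary: A rule: finite_induct)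
  case (insert x J)
  have inj: "inj_on (insert x) (Pow J)"
    using insert.hyps by (intro inj_onI) (metis PowD insert_ident subsetD)
  have *: "(-1) ^ card (insert x V) * of_bool (A \<subseteq> insert x V) =
      - ((-1) ^ card V * of_bool (A - {x} \<subseteq> V) :: 'a)" if "V \<in> Pow J" for V
  proof -
    have "finite V" "x \<notin> V" using that insert.hyps by (auto intro: finite_subset)
    then show ?thesis by (auto simp: subset_insert_iff)
  qed
  have "Pow J \<inter> insert x ` Pow J = {}" using insert.hyps by auto
  then have "(\<Sum>V\<in>Pow (insert x J). (-1) ^ card V * of_bool (A \<subseteq> V) :: 'a) =
      (\<Sum>V\<in>Pow J. (-1) ^ card V * of_bool (A \<subseteq> V)) +
      (\<Sum>V\<in>Pow J. (-1) ^ card (insert x V) * of_bool (A \<subseteq> insert x V))"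
    using inj insert.hyps by (simp add: Pow_insert sum.union_disjoint sum.reindex del: sum_mult_of_bool_eq)
  also have "\<dots> = (-1) ^ card J * (of_bool (A = J) - of_bool (A - {x} = J))"
    using * by (simp add: insert.IH sum_negf right_diff_distrib del: sum_mult_of_bool_eq)
  also have "\<dots> = (-1) ^ card (insert x J) * of_bool (A = insert x J)"
    using insert.hyps by (cases "x \<in> A") auto
  finally show ?case .
qed auto

subsection \<open>Frames\<close>

lemma blk_unique: "x \<in> blk d b \<Longrightarrow> x \<in> blk d c \<Longrightarrow> b = c"
  using blk_disjoint[of b c d] by blast

text \<open>Blocks are disjoint, so each heavy block uses up \<open>d\<close> elements of
  \<open>S\<close>.\<close>

lemma heavy_blocks:
  assumes "finite S" "0 < d"
  shows "finite {b. d \<le> card (S \<inter> blk d b)}" "d * card {b. d \<le> card (S \<inter> blk d b)} \<le> card S"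
proof -
  let ?X = "{b. d \<le> card (S \<inter> blk d b)}"
  have "d * card X \<le> card S" if "finite X" "X \<subseteq> ?X" for X
  proof -
    have "d * card X = (\<Sum>b\<in>X. d)" by simp
    also have "\<dots> \<le> (\<Sum>b\<in>X. card (S \<inter> blk d b))"
      using that(2) by (intro sum_mono) auto
    also have "\<dots> = card (\<Union>b\<in>X. S \<inter> blk d b)"
      using that(1) blk_disjoint by (intro card_UN_disjoint[symmetric]) (auto dest: blk_unique)
    also have "\<dots> \<le> card S"
      using assms(1) by (intro card_mono) auto
    finally show ?thesis .
  qed
  note * = this
  show "finite ?X"
  proof (rule ccontr)
    assume "infinite ?X"
    then obtain X where "X \<subseteq> ?X" "finite X" "card X = Suc (card S)"
      using infinite_arbitrarily_large by blast
    with *[of X] assms(2) show False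
      by (metis le_add1 less_Suc_eq_le mult.commute mult_le_mono2 mult_Suc not_less_eq_eq order_trans
          Suc_leI nat_mult_1_right)
  qed
  then show "d * card ?X \<le> card S" using * by simp
qed

text \<open>Pigeonhole on \<open>Suc K\<close> consecutive disjoint open intervals.\<close>

lemma gap_avoiding:
  fixes X :: "nat set"
  assumes "finite X" "card X \<le> K" "p + Suc K * g \<le> q" "0 < g"
  obtains p' q' where "p \<le> p'" "q' \<le> q" "p' + g \<le> q'" "X \<inter> {p'<..<q'} = {}"
proof -
  let ?I = "\<lambda>i. {p + i * g<..<p + Suc i * g}"
  have disj: "i = j" if "x \<in> ?I i" "x \<in> ?I j" for x i j
  proof (rule ccontr)
    assume "i \<noteq> j"
    then consider "Suc i \<le> j" | "Suc j \<le> i" by linarith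
    then show False
    proof cases
      case 1
      then have "Suc i * g \<le> j * g" by (rule mult_le_mono1)
      with that show False by simp
    next
      case 2
      then have "Suc j * g \<le> i * g" by (rule mult_le_mono1)
      with that show False by simp
    qed
  qed
  have "\<exists>i\<le>K. X \<inter> ?I i = {}"
  proof (rule ccontr)
    assume "\<not> ?thesis"
    then have "\<forall>i\<in>{..K}. \<exists>x. x \<in> X \<inter> ?I i" by blast
    then obtain f where f: "\<forall>i\<in>{..K}. f i \<in> X \<inter> ?I i" by metis
    then have "inj_on f {..K}" using disj by (intro inj_onI) (metis Int_iff)
    then have "card {..K} \<le> card X"
      using f assms(1) by (intro card_inj_on_le[of f]) auto
    with assms(2) show False by simp
  qed
  then obtain i where i: "i \<le> K" "X \<inter> ?I i = {}" by blast
  then have "Suc i * g \<le> Suc K * g" by (intro mult_le_mono1) simp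
  with that[of "p + i * g" "p + Suc i * g"] i assms show thesis by auto
qed

locale chain_params =
  fixes d K M :: nat
  assumes Kd: "2 * Suc K \<le> d" and KM: "(2 * Suc K) ^ Suc K \<le> Suc M"
begin

lemma d_pos: "0 < d"
  using Kd by simp

abbreviation sec :: "nat set \<Rightarrow> nat \<Rightarrow> nat set" where
  "sec S b \<equiv> S \<inter> blk d b"

text \<open>The length guaranteed at level \<open>v\<close>. Every later level may cost a factor
  \<open>Suc K\<close>, and the last interval must exceed Bennett's range \<open>2 ^ K\<close> by at
  least one block, for which \<open>2 ^ Suc K\<close> is enough.\<close>

definition gap :: "nat \<Rightarrow> nat" where
  "gap v = Suc K ^ (Suc K - v) * 2 ^ Suc K"

lemma gap_Suc: "v \<le> K \<Longrightarrow> gap v = Suc K * gap (Suc v)"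
  unfolding gap_def by (simp only: Suc_diff_le diff_Suc_Suc power_Suc mult.assoc)

lemma gap_lower: "2 ^ Suc K \<le> gap v"
  by (simp add: gap_def)

lemma gap_pos: "0 < gap v"
  by (simp add: gap_def)

text \<open>The earlier intervals are kept so that the construction can restart from any level. The
  last clause caps the strings chosen after level \<open>v\<close>: a section inside
  \<open>Y\<close> that misses the cardinality \<open>5 * d - 2 * Suc v\<close> is strictly smaller,
  and fits into the strings that a restart at \<open>v\<close> chooses.\<close>

definition frame :: "nat \<Rightarrow> (nat \<Rightarrow> nat) \<Rightarrow> (nat \<Rightarrow> nat) \<Rightarrow> nat set \<Rightarrow> bool" where
  "frame u P Q Y \<longleftrightarrow>
     u \<le> Suc K \<and> P 0 = 0 \<and> Q 0 = Suc M \<and>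
     (\<forall>v<u. P v \<le> P (Suc v) \<and> Q (Suc v) \<le> Q v) \<and>
     (\<forall>v\<le>u. P v + gap v \<le> Q v) \<and>
     (\<forall>b\<le>P u. good d (sec Y b)) \<and>
     (\<forall>b\<ge>Q u. \<not> good d (sec Y b)) \<and>
     (\<forall>b. P u < b \<and> b < Q u \<longrightarrow> card (sec Y b) = d) \<and>
     (\<forall>v<u. \<forall>b. P v < b \<and> b < Q v \<longrightarrow> card (sec Y b) \<le> 5 * d - 2 * Suc v)"

text \<open>On an alive support some functional has value 1; among small supports, the others are
  killed by every functional. Not being alive passes to supersets, which is what multiplication by
  variables requires.\<close>

definition alive :: "nat set \<Rightarrow> bool" where
  "alive S \<longleftrightarrow> (\<exists>u P Q Y. frame u P Q Y \<and> S \<subseteq> Y)"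

definition peb :: "nat set \<Rightarrow> nat set" where
  "peb R = {b. sec R b \<noteq> {}}"

text \<open>
  With \<open>R = S - Y\<close>, this is the value at the monomial with support \<open>S\<close>. Inside the interval, the
  bad state of a block is the signed sum of evaluations at the strings \<open>sec Y b \<union> W\<close> for nonempty
  \<open>W \<subseteq> J b\<close>; it differs from the good state \<open>sec Y b\<close> only on supports that contain \<open>J b\<close>, and these
  put a pebble on \<open>b\<close>. The set \<open>B\<close> is for pebbles that are split off in proofs.
\<close>

definition weight :: "nat \<Rightarrow> nat \<Rightarrow> (nat \<Rightarrow> nat set) \<Rightarrow> nat set \<Rightarrow> nat set \<Rightarrow> 'a::field" where
  "weight p q J B R =
     (if \<forall>b\<in>peb R. p < b \<and> b < q \<and> sec R b = J b
      then (- ((-1) ^ d)) ^ card (peb R) * pebbled K q (B \<union> peb R) else 0)"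

text \<open>Adding a nonempty part of \<open>J b\<close> to \<open>d\<close> elements of
  \<open>Y\<close> gives between \<open>d + 1\<close> and \<open>2 * d\<close> elements, never a
  good string. The size \<open>d\<close> also makes every pebbled block heavy.\<close>

definition pebble_sets :: "nat \<Rightarrow> nat \<Rightarrow> nat set \<Rightarrow> (nat \<Rightarrow> nat set) \<Rightarrow> bool" where
  "pebble_sets p q Y J \<longleftrightarrow> (\<forall>b. p < b \<and> b < q \<longrightarrow> J b \<subseteq> blk d b - Y \<and> card (J b) = d)"

section \<open>Existence of frames, and restarting a frame around a small support\<close>

lemma frame_mono:
  assumes "frame u P Q Y" "v \<le> u"
  shows "P v \<le> P u" "Q u \<le> Q v"
proof -
  have "P v \<le> P u \<and> Q u \<le> Q v"
    using assms(2)
  proof (induction "u - v" arbitrary: v)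
    case (Suc n)
    then have "P (Suc v) \<le> P u \<and> Q u \<le> Q (Suc v)" "v < u" by auto
    with assms(1) show ?case unfolding frame_def by (meson order_trans)
  qed simp
  then show "P v \<le> P u" "Q u \<le> Q v" by auto
qed

lemma set_of_sections:
  assumes "\<And>b. T b \<subseteq> blk d b"
  shows "sec (\<Union>b. T b) b = T b"
  using assms blk_unique by blast

lemma in_some_blk: "\<exists>b. x \<in> blk d b"
proof -
  have "x = x div (5 * d) * (5 * d) + x mod (5 * d)"
    by (rule div_mult_mod_eq[symmetric])
  moreover have "x mod (5 * d) < 5 * d" using d_pos by simp
  ultimately have "x \<in> blk d (x div (5 * d))"
    unfolding blk_def by (simp only: atLeastLessThan_iff mult_Suc) linarith
  then show ?thesis ..
qed

text \<open>At level 0 the strings have size \<open>d\<close> up to block \<open>M\<close> and are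
  empty, hence bad, from there on. The assumption \<open>KM\<close> is the length
  \<open>gap 0\<close>.\<close>

lemma frame_exists: "\<exists>u P Q Y. frame u P Q Y"
proof -
  have "\<forall>b. \<exists>T. T \<subseteq> blk d b \<and> card T = d"
  proof
    fix b
    have "d \<le> card (blk d b)" by simp
    then show "\<exists>T. T \<subseteq> blk d b \<and> card T = d" by (metis obtain_subset_with_card_n)
  qed
  then obtain T where T: "\<And>b. T b \<subseteq> blk d b" "\<And>b. card (T b) = d" by metis
  define Y where "Y = (\<Union>b. if b \<le> M then T b else {})"
  have Y: "sec Y b = (if b \<le> M then T b else {})" for b
    unfolding Y_def by (rule set_of_sections) (use T in auto)
  have "gap 0 = (2 * Suc K) ^ Suc K"
    unfolding gap_def power_mult_distrib by (simp only: diff_zero mult.commute)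
  then have "gap 0 \<le> Suc M"
    using KM by simp
  then have "frame 0 (\<lambda>_. 0) (\<lambda>_. Suc M) Y"
    using T d_pos by (auto simp: frame_def Y good_def)
  then show ?thesis by blast
qed

lemma pebble_sets_exist:
  assumes "frame u P Q Y"
  shows "\<exists>J. pebble_sets (P u) (Q u) Y J"
proof -
  have "\<exists>J. P u < b \<and> b < Q u \<longrightarrow> J \<subseteq> blk d b - Y \<and> card J = d" for b
  proof (cases "P u < b \<and> b < Q u")
    case True
    then have "card (sec Y b) = d" using assms by (auto simp: frame_def)
    moreover have "card (blk d b - Y) = card (blk d b) - card (sec Y b)"
      by (simp add: card_Diff_subset_Int Int_commute)
    ultimately have "d \<le> card (blk d b - Y)" by simp
    then show ?thesis by (metis obtain_subset_with_card_n)
  qed auto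
  then show ?thesis unfolding pebble_sets_def by metis
qed

lemma peb_empty [simp]: "peb {} = {}"
  by (simp add: peb_def)

lemma weight_alive:
  assumes "alive S"
  obtains u P Q Y J where "frame u P Q Y" "pebble_sets (P u) (Q u) Y J"
    "weight (P u) (Q u) J {} (S - Y) = (1 :: 'a::field)"
proof -
  obtain u P Q Y where f: "frame u P Q Y" "S - Y = {}"
    using assms unfolding alive_def by blast
  moreover obtain J where "pebble_sets (P u) (Q u) Y J"
    using pebble_sets_exist f(1) by blast
  moreover have "weight (P u) (Q u) J {} (S - Y) = (1 :: 'a)"
    unfolding f(2) by (simp add: weight_def)
  ultimately show thesis using that by blast
qed

text \<open>A support with nonzero weight may carry pebbles, and is covered without pebbles by
  another frame. A suitable level \<open>w\<close> is restarted: the new interval avoids the heavy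
  blocks, and the blocks around it get strings large enough to contain the sections of
  \<open>S\<close>.\<close>

lemma weight_nonzero_alive:
  assumes f: "frame u P Q Y" and J: "pebble_sets (P u) (Q u) Y J"
    and S: "finite S" "card S < d * Suc K"
    and ne: "weight (P u) (Q u) J B (S - Y) \<noteq> (0 :: 'a::field)"
  shows "alive S"
proof -
  let ?X = "{b. d \<le> card (sec S b)}"
  have uK: "u \<le> Suc K" using f by (simp add: frame_def)
  have "d * card ?X < d * Suc K"
    using heavy_blocks[OF S(1) d_pos] S(2) by (meson le_less_trans)
  then have "card ?X < Suc K"
    by (simp only: mult_less_cancel1)
  then have X: "finite ?X" "card ?X \<le> K"
    using heavy_blocks[OF S(1) d_pos] by auto
  \<comment> \<open>These \<open>Suc K\<close> cardinalities are distinct and at least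
    \<open>d\<close>, by \<open>Kd\<close>; attaining all of them would take \<open>Suc K\<close>
    heavy blocks.\<close>
  have "\<exists>w\<le>K. \<forall>b. card (sec S b) \<noteq> 5 * d - 2 * Suc w"
  proof (rule ccontr)
    assume "\<not> ?thesis"
    then have "\<forall>w\<in>{..K}. \<exists>b. card (sec S b) = 5 * d - 2 * Suc w" by auto
    then obtain g where g: "\<And>w. w \<le> K \<Longrightarrow> card (sec S (g w)) = 5 * d - 2 * Suc w"
      by (metis atMost_iff)
    have "inj_on g {..K}"
    proof (rule inj_onI)
      fix v w assume "v \<in> {..K}" "w \<in> {..K}" "g v = g w"
      then have "5 * d - 2 * Suc v = 5 * d - 2 * Suc w" "v \<le> K" "w \<le> K"
        using g[of v] g[of w] by auto
      moreover from this have "2 * Suc v \<le> d" "2 * Suc w \<le> d" using Kd by simp_all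
      ultimately show "v = w" by simp
    qed
    moreover have "g w \<in> ?X" if "w \<le> K" for w
      using g[OF that] that Kd by simp
    ultimately have "card {..K} \<le> card ?X"
      using X(1) by (intro card_inj_on_le[of g]) auto
    with X(2) show False by simp
  qed
  then obtain w0 where w0: "w0 \<le> K" "\<And>b. card (sec S b) \<noteq> 5 * d - 2 * Suc w0" by blast
  \<comment> \<open>If the level \<open>w0\<close> has not been reached yet, the frame is extended
    at its last level; in the current interval sections have at most \<open>2 * d\<close> elements
    anyway.\<close>
  define w where "w = min w0 u"
  have w: "w \<le> K" "w \<le> u" using w0 by (auto simp: w_def)
  have wd: "2 * Suc w \<le> d" using w(1) Kd by simp
  have peb: "P u < b \<and> b < Q u \<and> sec (S - Y) b = J b" if "\<not> sec S b \<subseteq> Y" for b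
  proof -
    have "b \<in> peb (S - Y)" using that by (auto simp: peb_def)
    moreover have "\<forall>b\<in>peb (S - Y). P u < b \<and> b < Q u \<and> sec (S - Y) b = J b"
      using ne unfolding weight_def by meson
    ultimately show ?thesis by blast
  qed
  \<comment> \<open>Strictness matters: the bad strings chosen below have one element fewer than
    \<open>5 * d - 2 * Suc w\<close>.\<close>
  have light: "card (sec S b) < 5 * d - 2 * Suc w" if b: "P w < b" "b < Q w" for b
  proof (cases "P u < b \<and> b < Q u")
    case True
    have "sec S b \<subseteq> sec Y b \<union> J b"
      using peb[of b] by blast
    moreover have "card (sec Y b) = d" "card (J b) = d" "finite (J b)"
      using f J True d_pos unfolding frame_def pebble_sets_def by (auto intro: card_ge_0_finite)
    ultimately have "card (sec S b) \<le> d + d"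
      by (metis card_Un_le card_mono finite_Int finite_Un finite_blk order_trans)
    then show ?thesis using wd d_pos by linarith
  next
    case False
    then have "w < u"
      using b w(2) by (metis le_neq_implies_less)
    then have "w = w0" by (auto simp: w_def)
    have "sec S b \<subseteq> sec Y b" using peb[of b] False by blast
    then have "card (sec S b) \<le> card (sec Y b)" by (intro card_mono) auto
    also have "\<dots> \<le> 5 * d - 2 * Suc w"
      using f b \<open>w < u\<close> unfolding frame_def by blast
    finally show ?thesis
      using w0(2)[of b] \<open>w = w0\<close> by (metis le_neq_implies_less)
  qed
  have "P w + Suc K * gap (Suc w) \<le> Q w"
    using f w gap_Suc[OF w(1)] unfolding frame_def by metis
  then obtain p' q' where pq: "P w \<le> p'" "q' \<le> Q w" "p' + gap (Suc w) \<le> q'" "?X \<inter> {p'<..<q'} = {}"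
    using gap_avoiding[OF X _ gap_pos] by metis
  have pq': "p' < q'" using pq(3) gap_pos[of "Suc w"] by linarith
  \<comment> \<open>The complement of the string in its block has even size \<open>2 * Suc w\<close>
    on the left, so the string is good, and odd size on the right, so it is bad. In between, size
    \<open>d\<close> suffices because no block there is heavy.\<close>
  define size where "size b = (if b \<le> p' then 5 * d - 2 * Suc w
    else if b < q' then d else 5 * d - 2 * Suc w - 1)" for b
  define T where "T b = (if P w < b \<and> b < Q w
    then SOME T. sec S b \<subseteq> T \<and> T \<subseteq> blk d b \<and> card T = size b else sec Y b)" for b
  have T_in: "sec S b \<subseteq> T b \<and> T b \<subseteq> blk d b \<and> card (T b) = size b" if b: "P w < b" "b < Q w" for b
  proof -
    have "card (sec S b) \<le> size b"
    proof (cases "p' < b \<and> b < q'")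
      case True
      with pq(4) have "b \<notin> ?X" by auto
      with True show ?thesis by (simp add: size_def)
    next
      case False
      then show ?thesis using light[OF b] by (auto simp: size_def)
    qed
    moreover have "size b \<le> card (blk d b)" by (simp add: size_def)
    ultimately have "\<exists>T. sec S b \<subseteq> T \<and> T \<subseteq> blk d b \<and> card T = size b"
      using exists_subset_between[of "sec S b" "size b" "blk d b"] by auto
    then show ?thesis
      using b unfolding T_def by (simp del: Int_subset_iff) (rule someI_ex)
  qed
  have T_out: "T b = sec Y b" if "b \<le> P w \<or> Q w \<le> b" for b
    using that by (auto simp: T_def)
  define Y' where "Y' = (\<Union>b. T b)"
  have Y': "sec Y' b = T b" for b
    unfolding Y'_def using T_in T_out by (intro set_of_sections) (metis inf_le2 not_le)
  define P' where "P' = P(Suc w := p')"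
  define Q' where "Q' = Q(Suc w := q')"
  have mono: "P w \<le> P u" "Q u \<le> Q w"
    using frame_mono[OF f w(2)] by auto
  have size_good: "good d (T b)" if "P w < b" "b \<le> p'" for b
    using T_in[of b] that pq pq' wd d_pos by (auto simp: good_def size_def)
  have size_bad: "\<not> good d (T b)" if "q' \<le> b" "b < Q w" for b
  proof -
    have "card (T b) = 5 * d - 2 * Suc w - 1" "5 * d - card (T b) = Suc (2 * Suc w)"
      using T_in[of b] that pq pq' wd d_pos by (auto simp: size_def)
    then show ?thesis using wd d_pos by (simp add: good_def)
  qed
  have "frame (Suc w) P' Q' Y'"
    unfolding frame_def Y'
  proof (intro conjI allI impI)
    show "Suc w \<le> Suc K" using w by simp
    show "P' 0 = 0" "Q' 0 = Suc M" using f by (auto simp: frame_def P'_def Q'_def)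
    fix v assume v: "v < Suc w"
    have "P v \<le> P (Suc v) \<and> Q (Suc v) \<le> Q v" if "v < w"
      using f that w unfolding frame_def by simp
    then show "P' v \<le> P' (Suc v)" "Q' (Suc v) \<le> Q' v"
      using v pq by (auto simp: P'_def Q'_def less_Suc_eq)
  next
    fix v assume "v \<le> Suc w"
    then show "P' v + gap v \<le> Q' v"
      using f pq w unfolding frame_def by (auto simp: P'_def Q'_def le_Suc_eq)
  next
    fix b assume "b \<le> P' (Suc w)"
    then show "good d (T b)"
      using size_good[of b] T_out[of b] f mono unfolding frame_def
      by (cases "b \<le> P w") (auto simp: P'_def)
  next
    fix b assume "Q' (Suc w) \<le> b"
    then show "\<not> good d (T b)"
      using size_bad[of b] T_out[of b] f mono unfolding frame_def
      by (cases "Q w \<le> b") (auto simp: Q'_def)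
  next
    fix b assume "P' (Suc w) < b \<and> b < Q' (Suc w)"
    then show "card (T b) = d"
      using T_in[of b] pq by (auto simp: P'_def Q'_def size_def)
  next
    fix v b assume v: "v < Suc w" and "P' v < b \<and> b < Q' v"
    then have b: "P v < b" "b < Q v" by (auto simp: P'_def Q'_def)
    show "card (T b) \<le> 5 * d - 2 * Suc v"
    proof (cases "P w < b \<and> b < Q w")
      case True
      then show ?thesis using T_in[of b] v wd d_pos by (auto simp: size_def)
    next
      case False
      with b v have "v < w" by (auto simp: less_Suc_eq)
      with False b f w show ?thesis
        unfolding frame_def using T_out[of b] by auto
    qed
  qed
  \<comment> \<open>Outside the interval of level \<open>w\<close> the strings are unchanged, and
    they contain the sections of \<open>S\<close> because pebbles lie only in the innermost
    interval.\<close>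
  moreover have "S \<subseteq> Y'"
  proof
    fix x assume "x \<in> S"
    obtain b where b: "x \<in> blk d b" using in_some_blk by blast
    have "sec S b \<subseteq> T b"
    proof (cases "P w < b \<and> b < Q w")
      case False
      then have "\<not> (P u < b \<and> b < Q u)" using mono by auto
      then have "sec S b \<subseteq> Y" using peb by blast
      with False show ?thesis using T_out[of b] by auto
    qed (use T_in in blast)
    with b \<open>x \<in> S\<close> show "x \<in> Y'" by (auto simp: Y'_def)
  qed
  ultimately show ?thesis unfolding alive_def by blast
qed

section \<open>Splitting off and moving a pebble in the weights\<close>

lemma pebbled_heavy:
  assumes J: "pebble_sets p q Y J" and S: "finite S" "card S < d * Suc K" "blk d b \<subseteq> S"
    and R: "R \<subseteq> S" "\<forall>c\<in>peb R. p < c \<and> c < q \<and> sec R c = J c"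
  shows "card (insert b (peb R)) \<le> K"
proof -
  let ?X = "{c. d \<le> card (sec S c)}"
  \<comment> \<open>A pebbled block contains all of \<open>J c\<close> and is heavy, as is the full
    block \<open>b\<close>. So the bound on \<open>S\<close> enforces the pebble limit.\<close>
  have "c \<in> ?X" if "c \<in> peb R" for c
  proof -
    have "card (sec R c) = d" using R(2) J that by (simp add: pebble_sets_def)
    then show ?thesis
      using card_mono[of "sec S c" "sec R c"] R(1) by auto
  qed
  moreover have "b \<in> ?X" using S(3) by (simp add: Int_absorb1)
  ultimately have "card (insert b (peb R)) \<le> card ?X"
    using heavy_blocks[OF S(1) d_pos] by (intro card_mono) auto
  also have "d * card ?X < d * Suc K"
    using heavy_blocks[OF S(1) d_pos] S(2) by (meson le_less_trans)
  then have "card ?X < Suc K" by (simp only: mult_less_cancel1)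
  then have "card ?X \<le> K" by simp
  finally show ?thesis .
qed

lemma peb_insert_sec: "peb R = (if sec R b = {} then peb (R - blk d b) else insert b (peb (R - blk d b)))"
proof -
  have "sec (R - blk d b) c = (if c = b then {} else sec R c)" for c
    using blk_disjoint[of b c d] by auto
  then show ?thesis by (auto simp: peb_def)
qed

lemma weight_eq_0_block:
  "b \<in> peb R \<Longrightarrow> \<not> (p < b \<and> b < q) \<or> sec R b \<noteq> J b \<Longrightarrow> weight p q J B R = 0"
  by (auto simp: weight_def)

lemma finite_peb: "finite R \<Longrightarrow> finite (peb R)"
proof -
  assume "finite R"
  moreover have "peb R \<subseteq> (\<Union>x\<in>R. {b. x \<in> blk d b})" by (auto simp: peb_def)
  moreover have "finite {b. x \<in> blk d b}" for x
  proof -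
    obtain b where "x \<in> blk d b" using in_some_blk by blast
    then have "{c. x \<in> blk d c} = {b}" using blk_unique by blast
    then show ?thesis by simp
  qed
  ultimately show ?thesis by (meson finite_UN_I finite_subset)
qed

text \<open>Expansion at an interior block: either there is no pebble on \<open>b\<close>, or the
  section is all of \<open>J b\<close> and its pebble moves into the parameter
  \<open>B\<close>.\<close>

lemma weight_split:
  assumes "finite R" and b: "p < b" "b < q" "J b \<noteq> {}"
  shows "weight p q J {} R = of_bool (sec R b = {}) * weight p q J {} (R - blk d b)
    - (-1) ^ d * of_bool (sec R b = J b) * (weight p q J {b} (R - blk d b) :: 'a::field)"
proof (cases "sec R b = {}")
  case True
  then have "R - blk d b = R" by blast
  with True b(3) show ?thesis by simp
next
  case False
  let ?R = "R - blk d b"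
  have peb: "peb R = insert b (peb ?R)"
    using peb_insert_sec[of R b] False by simp
  have sec: "sec ?R c = sec R c" if "c \<noteq> b" for c
    using blk_disjoint[OF that] by auto
  have b': "b \<notin> peb ?R" by (auto simp: peb_def)
  then have "(\<forall>c\<in>peb ?R. p < c \<and> c < q \<and> sec R c = J c) \<longleftrightarrow>
      (\<forall>c\<in>peb ?R. p < c \<and> c < q \<and> sec ?R c = J c)"
    by (intro ball_cong refl) (metis sec)
  then have "(\<forall>c\<in>peb R. p < c \<and> c < q \<and> sec R c = J c) \<longleftrightarrow>
      sec R b = J b \<and> (\<forall>c\<in>peb ?R. p < c \<and> c < q \<and> sec ?R c = J c)"
    unfolding peb ball_simps(7) using b(1,2) by blast
  moreover have "card (peb R) = Suc (card (peb ?R))"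
    unfolding peb using b' finite_peb[of ?R] assms(1) by simp
  ultimately show ?thesis
    using False unfolding weight_def by (simp add: peb del: Int_subset_iff)
qed

text \<open>Placing a pebble on \<open>b\<close> is a legal move: its successor is pebbled or is
  \<open>q\<close>, and the limit holds since the full block \<open>b\<close> counts among the heavy
  ones.\<close>

lemma weight_link:
  assumes J: "pebble_sets p q Y J" and S: "finite S" "card S < d * Suc K" "blk d b \<subseteq> S" "R \<subseteq> S"
    and b: "Suc b \<in> insert q (peb R)"
  shows "weight p q J {b} R = (weight p q J {} R :: 'a::field)"
proof (cases "\<forall>c\<in>peb R. p < c \<and> c < q \<and> sec R c = J c")
  case True
  from pebbled_heavy[OF J S this] b have "pebbled K q (insert b (peb R)) = (pebbled K q (peb R) :: 'a)"
    by (intro pebbled_insert)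
  then show ?thesis by (simp add: weight_def)
next
  case False
  then show ?thesis unfolding weight_def by (simp only: if_False)
qed

section \<open>Small products of monomials and axioms are killed\<close>

lemma frame_gap:
  assumes "frame u P Q Y"
  shows "P u + 2 ^ Suc K \<le> Q u"
proof -
  have "P u + gap u \<le> Q u" using assms by (simp add: frame_def)
  with gap_lower[of u] show ?thesis by linarith
qed

text \<open>For interior \<open>b\<close>, the weight is a signed sum of evaluations at bad strings
  on block \<open>b\<close>, where \<open>z\<close> is good, plus a remainder that is evaluated at
  the good string of \<open>Y\<close> on block \<open>Suc b\<close>, where \<open>z\<close> is bad.
  Other positions of \<open>b\<close> have a block on which the functional is evaluation at
  \<open>Y\<close> and \<open>Y\<close> contradicts \<open>z\<close>.\<close>

lemma weight_kills_link:
  fixes S :: "nat set"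
  assumes f: "frame u P Q Y" and J: "pebble_sets (P u) (Q u) Y J"
    and z: "chain_link d b z"
    and S: "finite S" "card (S \<union> (blk d b \<union> blk d (Suc b))) < d * Suc K"
  shows "lfun (\<lambda>X. weight (P u) (Q u) J {} (S \<union> X - Y))
    (clause_poly (box_clause (blk d b \<union> blk d (Suc b)) z) :: 'a::field polynomial) = 0"
proof -
  let ?V = "blk d b \<union> blk d (Suc b)" and ?p = "P u" and ?q = "Q u"
  define e where "e X = (weight ?p ?q J {} (S \<union> X - Y) :: 'a)" for X
  have zV: "z \<subseteq> ?V" "good d (z \<inter> blk d b)" "\<not> good d (z \<inter> blk d (Suc b))"
    using z by (auto simp: chain_link_def)
  have Y_good: "good d (sec Y c)" if "c < ?q" for c
    using f that by (cases "c \<le> ?p") (auto simp: frame_def good_def)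
  have Y_bad: "\<not> good d (sec Y c)" if "?q \<le> c" for c
    using f that by (auto simp: frame_def)
  \<comment> \<open>Outside the interval, leaving \<open>Y\<close> makes the weight 0. The same
    holds on the first interior block, which Bennett's bound puts out of reach of pebbles. So on
    block \<open>c\<close> the functional is evaluation at \<open>Y\<close>.\<close>
  have rigid: "lfun e (clause_poly (box_clause ?V z) :: 'a polynomial) = 0"
    if c: "c = b \<or> c = Suc b" "\<not> (?p < c \<and> c < ?q) \<or> c = Suc ?p" "sec Y c \<noteq> sec z c" for c
  proof (rule lfun_box_clause_eq_0)
    fix X
    show "e X = of_bool (sec X c \<subseteq> Y) * e (X - blk d c)"
    proof (cases "sec X c \<subseteq> Y")
      case True
      then have "S \<union> X - Y = S \<union> (X - blk d c) - Y" by auto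
      with True show ?thesis by (simp add: e_def)
    next
      case False
      then have peb: "c \<in> peb (S \<union> X - Y)" by (auto simp: peb_def)
      have "e X = 0"
      proof (cases "?p < c \<and> c < ?q")
        case True
        with c(2) have "c = Suc ?p" by simp
        moreover have "Suc ?p + 2 ^ K \<le> ?q"
        proof -
          have "(1 :: nat) \<le> 2 ^ K" by simp
          with frame_gap[OF f] show ?thesis unfolding power_Suc by linarith
        qed
        ultimately have "pebbled K ?q (peb (S \<union> X - Y)) = (0 :: 'a)"
          using peb by (intro pebbled_far[of c]) auto
        then show ?thesis by (simp add: e_def weight_def)
      qed (use weight_eq_0_block[OF peb, of ?p ?q J "{}"] in \<open>simp add: e_def\<close>)
      with False show ?thesis by simp
    qed
  qed (use zV c in auto)
  consider "b \<le> ?p" | "?q \<le> b" | "?p < b" "b < ?q" by linarith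
  then have "lfun e (clause_poly (box_clause ?V z) :: 'a polynomial) = 0"
  proof cases
    case 1
    \<comment> \<open>Block \<open>Suc b\<close> is fixed and good or is the first interior block,
      so \<open>rigid\<close> applies to it.\<close>
    have "Suc b < ?q"
    proof -
      have "(1 :: nat) \<le> 2 ^ K" by simp
      with 1 frame_gap[OF f] show ?thesis unfolding power_Suc by linarith
    qed
    with 1 Y_good[of "Suc b"] zV show ?thesis
      by (intro rigid[of "Suc b"]) auto
  next
    case 2
    with Y_bad[of b] zV show ?thesis
      by (intro rigid[of b]) auto
  next
    case 3
    let ?D = "blk d b" and ?D' = "blk d (Suc b)" and ?J = "J b"
    have Jb: "?J \<subseteq> ?D - Y" "card ?J = d"
      using J 3 by (auto simp: pebble_sets_def)
    then have "finite ?J" "?J \<noteq> {}" using d_pos by (auto intro: card_ge_0_finite)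
    have disj: "?D \<inter> ?D' = {}" using blk_disjoint[of b "Suc b"] by simp
    define A where "A X = sec (S \<union> X - Y) b" for X
    define v where "v X = (weight ?p ?q J {} (S \<union> X - Y - ?D) :: 'a)" for X
    \<comment> \<open>The effect of a pebble on \<open>b\<close>. It vanishes if
      \<open>Suc b\<close> is pebbled or equals \<open>?q\<close>, since the pebble can then be
      placed at will.\<close>
    define \<delta> where "\<delta> X = weight ?p ?q J {b} (S \<union> X - Y - ?D) - v X" for X
    define f1 where "f1 W X = of_bool (A X \<subseteq> W) * v X" for W X
    define f2 where "f2 X = of_bool (A X = ?J) * \<delta> X" for X
    have \<delta>: "\<delta> X = 0" if X: "X \<subseteq> ?V" and c: "Suc b = ?q \<or> \<not> sec X (Suc b) \<subseteq> Y" for X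
    proof -
      have "Suc b \<in> peb (S \<union> X - Y - ?D)" if "\<not> sec X (Suc b) \<subseteq> Y"
        using that disj by (auto simp: peb_def)
      then have "Suc b \<in> insert ?q (peb (S \<union> X - Y - ?D))" using c by blast
      then have "weight ?p ?q J {b} (S \<union> X - Y - ?D) = v X"
        unfolding v_def using S X
        by (intro weight_link[OF J, of "S \<union> ?V"]) auto
      then show ?thesis by (simp add: \<delta>_def)
    qed
    have e_eq: "e X = (\<Sum>W\<in>Pow ?J - {{}}. - ((-1) ^ card W) * f1 W X) + - ((-1) ^ d) * f2 X"
      if "X \<subseteq> ?V" for X
    proof -
      have "finite (S \<union> X - Y)" using S(1) that by (auto intro: finite_subset)
      from weight_split[OF this 3, of J] \<open>?J \<noteq> {}\<close>
      have "e X = of_bool (A X = {}) * v X - (-1) ^ d * of_bool (A X = ?J) * (v X + \<delta> X)"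
        by (simp add: e_def v_def \<delta>_def A_def)
      also have "\<dots> = (of_bool (A X = {}) - (-1) ^ d * of_bool (A X = ?J)) * v X + - ((-1) ^ d) * f2 X"
        by (simp add: f2_def algebra_simps)
      \<comment> \<open>The sum over all \<open>W\<close> equals
        \<open>(-1) ^ d * of_bool (A X = ?J)\<close>, and its term for \<open>W = {}\<close> is the
        test \<open>A X = {}\<close>. This explains the factor \<open>- ((-1) ^ d)\<close> per
        pebble in the weight.\<close>
      also have "of_bool (A X = {}) - (-1) ^ d * of_bool (A X = ?J) =
          - (\<Sum>W\<in>Pow ?J - {{}}. (-1) ^ card W * of_bool (A X \<subseteq> W) :: 'a)"
      proof -
        have "(\<Sum>W\<in>Pow ?J. (-1) ^ card W * of_bool (A X \<subseteq> W) :: 'a) =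
            of_bool (A X = {}) + (\<Sum>W\<in>Pow ?J - {{}}. (-1) ^ card W * of_bool (A X \<subseteq> W))"
          using \<open>finite ?J\<close> by (subst sum.remove[of _ "{}"]) auto
        then show ?thesis
          using alternating_sum_supersets[OF \<open>finite ?J\<close>, of "A X", where 'a='a] Jb(2)
          by (simp add: algebra_simps del: sum_mult_of_bool_eq)
      qed
      finally show ?thesis
        by (simp add: f1_def sum_distrib_right sum_negf mult.assoc del: sum_mult_of_bool_eq)
    qed
    have f1: "lfun (f1 W) (clause_poly (box_clause ?V z)) = 0" if W: "W \<in> Pow ?J - {{}}" for W
    proof (rule lfun_box_clause_eq_0)
      have "(Y \<union> W) \<inter> ?D = sec Y b \<union> W" using W Jb by auto
      moreover have "card (sec Y b) = d" using f 3 by (simp add: frame_def)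
      moreover have "finite W" "sec Y b \<inter> W = {}"
        using W Jb \<open>finite ?J\<close> by (auto intro: finite_subset)
      moreover have "card W \<le> d" "0 < card W"
        using W Jb(2) \<open>finite ?J\<close> \<open>finite W\<close> card_mono[of ?J W] by (auto simp: card_gt_0_iff)
      ultimately have "card ((Y \<union> W) \<inter> ?D) = d + card W" by (simp add: card_Un_disjoint)
      then have "\<not> good d ((Y \<union> W) \<inter> ?D)"
        using \<open>card W \<le> d\<close> \<open>0 < card W\<close> by (simp add: good_def)
      with zV show "(Y \<union> W) \<inter> ?D \<noteq> z \<inter> ?D" by metis
      fix X
      have "S \<union> X - Y - ?D = S \<union> (X - ?D) - Y - ?D" by blast
      then show "f1 W X = of_bool (sec X b \<subseteq> Y \<union> W) *
          (of_bool (sec S b \<subseteq> Y \<union> W) * v (X - ?D))"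
        by (auto simp: f1_def v_def A_def)
    qed (use zV in auto)
    have f2: "lfun f2 (clause_poly (box_clause ?V z)) = 0"
    proof (cases "Suc b = ?q")
      \<comment> \<open>Next to the right end, the permanent pebble on \<open>?q\<close> makes
        \<open>\<delta>\<close> vanish throughout.\<close>
      case True
      then have "lfun f2 (clause_poly (box_clause ?V z)) = lfun (\<lambda>_. 0) (clause_poly (box_clause ?V z))"
        using zV(1) \<delta> by (intro lfun_cong) (simp add: poly_vars_clause_poly_box_clause f2_def)
      then show ?thesis by simp
    next
      case False
      show ?thesis
      proof (rule lfun_box_clause_eq_0)
        show "Y \<inter> ?D' \<noteq> z \<inter> ?D'"
          using Y_good[of "Suc b"] zV 3 False by auto
        fix X assume X: "X \<subseteq> ?V"
        show "f2 X = of_bool (sec X (Suc b) \<subseteq> Y) * f2 (X - ?D')"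
        proof (cases "sec X (Suc b) \<subseteq> Y")
          case True
          then have "S \<union> X - Y = S \<union> (X - ?D') - Y" by auto
          with True show ?thesis by (simp add: f2_def A_def \<delta>_def v_def)
        qed (use \<delta>[OF X] in \<open>simp add: f2_def\<close>)
      qed (use zV in auto)
    qed
    have "lfun e (clause_poly (box_clause ?V z)) =
        lfun (\<lambda>X. (\<Sum>W\<in>Pow ?J - {{}}. - ((-1) ^ card W) * f1 W X) + - ((-1) ^ d) * f2 X)
          (clause_poly (box_clause ?V z))"
      using zV(1) e_eq by (intro lfun_cong) (simp add: poly_vars_clause_poly_box_clause)
    also have "\<dots> = (\<Sum>W\<in>Pow ?J - {{}}. - ((-1) ^ card W) * lfun (f1 W) (clause_poly (box_clause ?V z)))
        + - ((-1) ^ d) * lfun f2 (clause_poly (box_clause ?V z))"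
      by (simp only: lfun_add_fun lfun_sum_fun lfun_cmult_fun)
    also have "\<dots> = 0"
      by (simp add: f1 f2)
    finally show ?thesis .
  qed
  then show ?thesis by (simp add: e_def[abs_def])
qed

text \<open>A fixed block admits no pebble, so on it the functional is evaluation at
  \<open>Y\<close>.\<close>

lemma weight_kills_end:
  assumes f: "frame u P Q Y"
    and z: "z \<subseteq> blk d b" "\<not> (P u < b \<and> b < Q u)" "z \<noteq> sec Y b"
  shows "lfun (\<lambda>X. weight (P u) (Q u) J {} (S \<union> X - Y))
    (clause_poly (box_clause (blk d b) z) :: 'a::field polynomial) = 0"
proof (rule lfun_box_clause_eq_0)
  fix X
  show "weight (P u) (Q u) J {} (S \<union> X - Y) =
      of_bool (sec X b \<subseteq> Y) * (weight (P u) (Q u) J {} (S \<union> (X - blk d b) - Y) :: 'a)"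
  proof (cases "sec X b \<subseteq> Y")
    case True
    then have "S \<union> X - Y = S \<union> (X - blk d b) - Y" by auto
    with True show ?thesis by simp
  next
    case False
    then have "b \<in> peb (S \<union> X - Y)" by (auto simp: peb_def)
    from weight_eq_0_block[OF this, of "P u" "Q u" J "{}"] z(2) False show ?thesis by simp
  qed
qed (use z in auto)

lemma weight_kills_axiom:
  fixes a :: "'a::field polynomial"
  assumes f: "frame u P Q Y" and J: "pebble_sets (P u) (Q u) Y J"
    and a: "a \<in> axioms_of (chain_cnf d M)"
    and small: "card (poly_vars (Poly_Mapping.single k 1 * a)) < d * Suc K"
  shows "lfun (\<lambda>S. weight (P u) (Q u) J {} (S - Y)) (Poly_Mapping.single k 1 * a) = 0"
proof -
  let ?S = "Poly_Mapping.keys k"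
  have *: "lfun (\<lambda>S. weight (P u) (Q u) J {} (S - Y)) (Poly_Mapping.single k 1 * a) =
      lfun (\<lambda>X. weight (P u) (Q u) J {} (?S \<union> X - Y)) a"
    by (simp add: lfun_single_mult)
  from a consider
      z where "a = clause_poly (box_clause (blk d 0) z)" "z \<subseteq> blk d 0" "\<not> good d z"
    | z where "a = clause_poly (box_clause (blk d (Suc M)) z)" "z \<subseteq> blk d (Suc M)" "good d z"
    | b z where "a = clause_poly (box_clause (blk d b \<union> blk d (Suc b)) z)" "b \<le> M" "chain_link d b z"
    | x where "a = Var x ^ 2 - Var x"
    unfolding axioms_of_def chain_cnf_def by blast
  then show ?thesis
  proof cases
    case 1
    have "good d (sec Y 0)" using f by (simp add: frame_def)
    with 1 show ?thesis
      unfolding * unfolding 1(1) by (intro weight_kills_end[OF f]) auto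
  next
    case 2
    have "Q u \<le> Suc M"
      using f frame_mono[OF f, of 0] by (simp add: frame_def)
    with 2 f have "\<not> good d (sec Y (Suc M))" by (simp add: frame_def)
    with 2 \<open>Q u \<le> Suc M\<close> show ?thesis
      unfolding * unfolding 2(1) by (intro weight_kills_end[OF f]) auto
  next
    case 3
    let ?V = "blk d b \<union> blk d (Suc b)"
    have "z \<subseteq> ?V" using 3 by (simp add: chain_link_def)
    then have "?S \<union> ?V \<subseteq> poly_vars (Poly_Mapping.single k 1 * a)"
      using poly_vars_single_mult_superset[of a k] clause_poly_box_clause_nonzero[of ?V z, where 'a='a]
        poly_vars_clause_poly_box_clause[of ?V z, where 'a='a] 3(1) by simp
    then have "card (?S \<union> ?V) < d * Suc K"
      using small by (meson card_mono le_less_trans poly_vars_finite)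
    with 3 f J show ?thesis
      unfolding * unfolding 3(1) by (intro weight_kills_link) auto
  next
    case 4
    have "lfun e (Var x ^ 2 - Var x :: 'a polynomial) = 0" for e
    proof -
      have "Var x ^ 2 - Var x = Var x * (Var x * 1) - Var x * (1 :: 'a polynomial)"
        by (simp add: power2_eq_square)
      then show ?thesis by (simp only: lfun_diff lfun_Var_mult) simp
    qed
    then show ?thesis unfolding * unfolding 4 .
  qed
qed

subsection \<open>The lower bound\<close>

text \<open>The common kernel of all functionals, a linear space that serves as the invariant of MC
  refutations in small space.\<close>

definition null :: "'a::field polynomial \<Rightarrow> bool" where
  "null p \<longleftrightarrow> (\<forall>u P Q Y J. frame u P Q Y \<and> pebble_sets (P u) (Q u) Y J \<longrightarrow>
     lfun (\<lambda>S. weight (P u) (Q u) J {} (S - Y)) p = 0)"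

lemma not_null_1: "\<not> null (1 :: 'a::field polynomial)"
proof
  assume "null (1 :: 'a polynomial)"
  moreover obtain u P Q Y where f: "frame u P Q Y" using frame_exists by blast
  moreover obtain J where "pebble_sets (P u) (Q u) Y J" using pebble_sets_exist[OF f] by blast
  ultimately have "lfun (\<lambda>S. weight (P u) (Q u) J {} (S - Y)) (1 :: 'a polynomial) = 0"
    by (auto simp: null_def)
  then show False
    unfolding single_one[symmetric] lfun_single by (simp add: weight_def)
qed

lemma Var_mult_single: "Var x * (Poly_Mapping.single m 1 * a) =
    Poly_Mapping.single (Poly_Mapping.single x 1 + m) 1 * (a :: 'a::field polynomial)"
  by (simp add: Var_def mult_single flip: mult.assoc)

text \<open>A null monomial has a support that is not alive; larger supports are not alive either,
  and while small they have weight 0 in every frame. A monomial multiple of an axiom stays one after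
  multiplication by \<open>x\<close>.\<close>

lemma null_Var_mult:
  fixes p :: "'a::field polynomial"
  assumes p: "null p" "mult_allowed MC (chain_cnf d M) p"
    and small: "card (poly_vars (Var x * p)) < d * Suc K"
  shows "null (Var x * p)"
proof -
  from p(2) consider m where "p = Poly_Mapping.single m 1"
    | m a where "a \<in> axioms_of (chain_cnf d M)" "p = Poly_Mapping.single m 1 * a"
    by (auto simp: is_monomial_def)
  then show ?thesis
  proof cases
    case 1
    let ?S = "insert x (Poly_Mapping.keys m)"
    have "poly_vars (Var x * p) = ?S"
      unfolding 1 Var_def by (auto simp: poly_vars_def mult_single keys_plus_nat)
    then have S: "finite ?S" "card ?S < d * Suc K" using small by auto
    have "\<not> alive (Poly_Mapping.keys m)"
    proof
      assume "alive (Poly_Mapping.keys m)"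
      then obtain u P Q Y J where "frame u P Q Y" "pebble_sets (P u) (Q u) Y J"
        "weight (P u) (Q u) J {} (Poly_Mapping.keys m - Y) = (1 :: 'a)"
        by (rule weight_alive)
      with p(1) show False unfolding null_def 1 by fastforce
    qed
    then have "\<not> alive ?S" unfolding alive_def by blast
    then have "weight (P u) (Q u) J {} (?S - Y) = (0 :: 'a)"
      if "frame u P Q Y" "pebble_sets (P u) (Q u) Y J" for u P Q Y J
      using weight_nonzero_alive[OF that S] by blast
    then show ?thesis unfolding null_def 1 by simp
  next
    case 2
    with small show ?thesis
      unfolding null_def 2(2) Var_mult_single using weight_kills_axiom by blast
  qed
qed

lemma step_null:
  fixes C :: "'a::field config"
  assumes "step MC (chain_cnf d M) C C'" and C: "finite C" "\<And>p. p \<in> C \<Longrightarrow> null p"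
    and small: "card (config_vars C') < d * Suc K"
  shows "finite C' \<and> (\<forall>p\<in>C'. null p)"
proof -
  have vars: "card (poly_vars p) < d * Suc K" if "p \<in> C'" "finite C'" for p
  proof -
    have "poly_vars p \<subseteq> config_vars C'" using that by (auto simp: config_vars_def)
    moreover have "finite (config_vars C')" using that(2) by (simp add: config_vars_def)
    ultimately show ?thesis using small by (meson card_mono le_less_trans)
  qed
  from assms(1) show ?thesis
  proof cases
    case (download a)
    then have "card (poly_vars (Poly_Mapping.single 0 1 * a)) < d * Suc K"
      using vars[of a] C(1) by simp
    from weight_kills_axiom[OF _ _ download(2) this] have "null a"
      unfolding null_def by simp
    with download C show ?thesis by simp
  next
    case (erasure p)
    with C show ?thesis by simp
  next
    case (inference p)
    from inference(2) have "null p"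
    proof cases
      case (linear_combination q r)
      then have "null q" "null r" using C(2) by auto
      then show ?thesis
        unfolding linear_combination(1) null_def by (simp add: lfun_add)
    next
      case (multiplication q x)
      have "card (poly_vars p) < d * Suc K"
        using vars[of p] inference(1) C(1) by simp
      then show ?thesis
        using multiplication C(2) unfolding multiplication(1) by (intro null_Var_mult)
    qed
    with inference C show ?thesis by simp
  qed
qed

text \<open>The minimum is attained because refutations exist. In smaller space every configuration
  would consist of null polynomials, but 1 is not null.\<close>

lemma MC_VSpace_chain_cnf: "d * Suc K \<le> VSpace TYPE('a::field) MC (chain_cnf d M)"
proof -
  let ?F = "chain_cnf d M"
  have "\<exists>\<pi> :: 'a config list. is_refutation MC ?F \<pi>"
    by (intro refutation_exists is_cnf_chain_cnf unsatisfiable_chain_cnf)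
  then have "VSpace TYPE('a) MC ?F \<in> refutation_vspace ` {\<pi> :: 'a config list. is_refutation MC ?F \<pi>}"
    unfolding VSpace_def by (intro Inf_nat_def1) auto
  then obtain \<pi> :: "'a config list" where \<pi>: "is_refutation MC ?F \<pi>"
    "VSpace TYPE('a) MC ?F = refutation_vspace \<pi>" by blast
  show ?thesis
  proof (rule ccontr)
    assume less: "\<not> ?thesis"
    have small: "card (config_vars C) < d * Suc K" if "C \<in> set \<pi>" for C
    proof -
      have "card (config_vars C) \<le> refutation_vspace \<pi>"
        unfolding refutation_vspace_def using that by (intro Max_ge) auto
      with less \<pi>(2) show ?thesis by (metis not_le le_less_trans)
    qed
    have "\<forall>D\<in>set (C # \<pi>'). finite D \<and> (\<forall>p\<in>D. null p)"
      if "successively (step MC ?F) (C # \<pi>')" "finite C \<and> (\<forall>p\<in>C. null p)"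
        "\<forall>D\<in>set \<pi>'. card (config_vars D) < d * Suc K" for C and \<pi>' :: "'a config list"
      using that
    proof (induction \<pi>' arbitrary: C)
      case (Cons D \<pi>')
      then have "finite D \<and> (\<forall>p\<in>D. null p)"
        by (intro step_null[of C]) auto
      with Cons show ?case by auto
    qed simp
    moreover obtain \<pi>' where "\<pi> = {} # \<pi>'"
      using \<pi>(1) by (cases \<pi>) (auto simp: is_refutation_def)
    ultimately have "\<forall>D\<in>set \<pi>. \<forall>p\<in>D. null p"
      using \<pi>(1) small by (auto simp: is_refutation_def)
    moreover have "{1} \<in> set \<pi>"
      using \<pi>(1) last_in_set[of \<pi>] by (auto simp: is_refutation_def)
    ultimately show False using not_null_1 by blast
  qed
qed

end

text \<open>With \<open>d = Suc n\<close> and \<open>M = n\<close> there are quadratically many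
  variables. The lower bound follows from taking \<open>Suc K\<close> close to
  \<open>ln n / (2 * ln (ln n))\<close>.\<close>

theorem theorem4p4:
  "\<exists>F :: nat \<Rightarrow> cnf.
     (\<forall>n. is_cnf (F n) \<and> unsatisfiable (F n)) \<and>
     (\<exists>k::nat. (\<lambda>n. real (card (cnf_vars (F n)))) \<in> O(\<lambda>n. real n ^ k)) \<and>
     (\<lambda>n. real (VSpace TYPE('a::field) PC (F n))) \<in> O(\<lambda>n. real n) \<and>
     (\<lambda>n. real (VSpace TYPE('a::field) MC (F n))) \<in>
       \<Omega>(\<lambda>n. real n * ln (real n) / ln (ln (real n)))"
proof (intro exI[of _ "\<lambda>n. chain_cnf (Suc n) n"] conjI allI exI[of _ 2])
  show "is_cnf (chain_cnf (Suc n) n)" "unsatisfiable (chain_cnf (Suc n) n)" for n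
    by (rule is_cnf_chain_cnf unsatisfiable_chain_cnf)+
  have "norm (real (card (cnf_vars (chain_cnf (Suc n) n)))) \<le> norm (real ((n + 2) * (5 * Suc n)))" for n
    unfolding real_norm_def abs_of_nat of_nat_le_iff by (rule card_cnf_vars_chain_cnf) simp
  then have "(\<lambda>n. real (card (cnf_vars (chain_cnf (Suc n) n)))) \<in> O(\<lambda>n. real ((n + 2) * (5 * Suc n)))"
    by (intro landau_o.big_mono always_eventually allI)
  also have "(\<lambda>n. real ((n + 2) * (5 * Suc n))) \<in> O(\<lambda>n. real n ^ 2)"
    by simp real_asymp
  finally show "(\<lambda>n. real (card (cnf_vars (chain_cnf (Suc n) n)))) \<in> O(\<lambda>n. real n ^ 2)" .
  have "norm (real (VSpace TYPE('a) PC (chain_cnf (Suc n) n))) \<le> norm (real (10 * Suc n))" for n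
    unfolding real_norm_def abs_of_nat of_nat_le_iff by (rule PC_VSpace_chain_cnf) simp
  then have "(\<lambda>n. real (VSpace TYPE('a) PC (chain_cnf (Suc n) n))) \<in> O(\<lambda>n. real (10 * Suc n))"
    by (intro landau_o.big_mono always_eventually allI)
  also have "(\<lambda>n. real (10 * Suc n)) \<in> O(\<lambda>n. real n)"
    by simp real_asymp
  finally show "(\<lambda>n. real (VSpace TYPE('a) PC (chain_cnf (Suc n) n))) \<in> O(\<lambda>n. real n)" .
  have "eventually (\<lambda>n. 1 / 4 * (real n * ln (real n) / ln (ln (real n))) \<le>
      real (VSpace TYPE('a) MC (chain_cnf (Suc n) n))) at_top"
  proof -
    \<comment> \<open>For \<open>Suc K \<le> r n\<close>, the required chain length is at most
      \<open>exp (r n * ln (ln n))\<close>, the square root of \<open>n\<close>, because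
      \<open>2 * Suc K \<le> ln n\<close>.\<close>
    define r where "r n = ln (real n) / (2 * ln (ln (real n)))" for n
    have "eventually (\<lambda>n. 2 \<le> r n \<and> 1 \<le> ln (ln (real n)) \<and> 1 \<le> ln (real n) \<and> 1 \<le> real n) at_top"
      unfolding r_def by (intro eventually_conj; real_asymp)
    then show ?thesis
    proof eventually_elim
      case (elim n)
      define K where "K = nat \<lfloor>r n\<rfloor> - 1"
      have "real (Suc K) = of_int \<lfloor>r n\<rfloor>"
        using elim by (simp add: K_def le_floor_iff of_nat_diff)
      then have K: "real (Suc K) \<le> r n" "r n - 1 \<le> real (Suc K)"
        by linarith+
      have "2 * r n \<le> ln (real n)"
        using elim mult_left_mono[of 1 "ln (ln (real n))" "ln (real n)"]
        by (simp add: r_def divide_le_eq)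
      then have "(2 * real (Suc K)) ^ Suc K \<le> ln (real n) ^ Suc K"
        using K by (intro power_mono) auto
      also have "\<dots> = exp (real (Suc K) * ln (ln (real n)))"
        unfolding exp_of_nat_mult using elim by (subst exp_ln) linarith+
      also have "\<dots> \<le> exp (r n * ln (ln (real n)))"
        using K elim by (intro exp_le_cancel_iff[THEN iffD2] mult_right_mono) auto
      also have "\<dots> = exp (ln (real n) / 2)"
        using elim by (simp add: r_def)
      also have "\<dots> \<le> exp (ln (real n))"
        using elim by (intro exp_le_cancel_iff[THEN iffD2]) auto
      also have "\<dots> \<le> real (Suc n)"
        using elim by simp
      finally have "real ((2 * Suc K) ^ Suc K) \<le> real (Suc n)"
        by (simp only: of_nat_power of_nat_mult of_nat_numeral)
      then have KM: "(2 * Suc K) ^ Suc K \<le> Suc n"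
        by (simp only: of_nat_le_iff)
      moreover have "2 * Suc K \<le> (2 * Suc K) ^ Suc K"
        by (intro self_le_power) auto
      ultimately interpret chain_params "Suc n" K n
        by unfold_locales auto
      \<comment> \<open>From \<open>2 \<le> r n\<close> follows
        \<open>r n / 2 \<le> r n - 1\<close>, which absorbs the rounding; with the 2 in the
        definition of \<open>r\<close> this gives the constant 1/4.\<close>
      have "1 / 4 * (real n * ln (real n) / ln (ln (real n))) = real n * (r n / 2)"
        by (simp add: r_def)
      also have "\<dots> \<le> real (Suc n) * real (Suc K)"
        using K elim by (intro mult_mono) auto
      also have "\<dots> \<le> real (VSpace TYPE('a) MC (chain_cnf (Suc n) n))"
        using MC_VSpace_chain_cnf[where 'a='a] by (metis of_nat_le_iff of_nat_mult)
      finally show ?case .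
    qed
  qed
  moreover have "eventually (\<lambda>n. 0 \<le> real n * ln (real n) / ln (ln (real n))) at_top"
    by real_asymp
  ultimately have "eventually (\<lambda>n. 1 / 4 * norm (real n * ln (real n) / ln (ln (real n))) \<le>
      norm (real (VSpace TYPE('a) MC (chain_cnf (Suc n) n)))) at_top"
    by eventually_elim simp
  then show "(\<lambda>n. real (VSpace TYPE('a) MC (chain_cnf (Suc n) n))) \<in>
      \<Omega>(\<lambda>n. real n * ln (real n) / ln (ln (real n)))"
    by (intro landau_omega.bigI[of "1 / 4"]) auto
qed

end
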